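(* Let $K(\Omega)$ be a quasi-$K_\sigma$-space of random variables with quasinorm $\|\cdot\|_K$ subordinate to a function $j=\{j(\lambda),\lambda\in[0,1]\}$ and with majorizing characteristic $\mu(n)$. Let $(T,\rho)$ be a separable pseudometric space, $T=\bigcup_{k=1}^\infty B_k$, where the $B_k$ are compact sets. Let $X=(X(t),t\in T)$ be a separable random process with $X(t)\in K(\Omega)$ for every $t\in T$, and let $\sigma=\{\sigma(h),h\ge 0\}$ be a continuous monotonically increasing function with $\sigma(0)=0$ such that $\sup_{\rho(t,s)\le h}\|X(t)-X(s)\|_K\le\sigma(h)$. Let $c(t)$ be a function on $T$ with $|c(t)|<1$. Then $$\Big\|\sup_{t\in T}|c(t)X(t)|\Big\|_K\le\sum_{k=1}^\infty j(\gamma_k)\Big(\delta_k+\sum_{l=0}^\infty\mu\big(N_{B_k}(\varepsilon_{k,l+1})\big)\sigma(\varepsilon_{k,l})\Big),$$ where for each $k$: $(\varepsilon_{k,l})_{l\ge0}$ is any monotonically decreasing sequence with $\varepsilon_{k,l}\to0$ as $l\to\infty$ and $\varepsilon_{k,0}$ the smallest number for which there is a point $t_0\in B_k$ with $\rho(t,t_0)\le\varepsilon_{k,0}$ for all $t\in B_k$; $\delta_k=\sup_{t\in B_k}\|X(t)\|_K$; $\gamma_k=\sup_{t\in B_k}|c(t)|$.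
   Context: A quasinorm on a space $K(\Omega)$ of random variables is a functional $\|\cdot\|\ge0$ with: $\|\xi\|=0\iff\xi=0$ a.s.; $\|\xi+\eta\|\le\|\xi\|+\|\eta\|$; $\|\lambda\xi\|\le\|\xi\|$ for $|\lambda|\le1$. It is subordinate to a monotonically non-decreasing function $j:[0,1]\to[0,\infty)$ with $j(\lambda)\to0$ as $\lambda\to0$ if $\|\lambda\xi\|\le j(|\lambda|)\|\xi\|$ for $|\lambda|\le1$. A quasi-Banach space is a space complete with respect to the quasinorm. A quasi-Banach space $K(\Omega)$ is a quasi-$K_\sigma$-space if: (a1) $\xi,\eta\in K(\Omega)$ implies $\max(\xi,\eta),\min(\xi,\eta)\in K(\Omega)$; (a2) if $\xi,\eta\in K(\Omega)$ and $|\xi|\le|\eta|$ a.s., then $\|\xi\|\le\|\eta\|$; (a3) if $\xi_n\in K(\Omega)$, $n\ge1$, and $\sup_n|\xi_n|\le\eta$ for some $\eta\in K(\Omega)$, then $\sup_n|\xi_n|\in K(\Omega)$. A non-decreasing numerical sequence $(\mu(n),n\ge1)$ is a majorizing characteristic of $K(\Omega)$ if $\|\max_{1\le i\le n}|\xi_i|\|\le\mu(n)\max_{1\le i\le n}\|\xi_i\|$ for all $\xi_1,\dots,\xi_n\in K(\Omega)$. For compact $B$, $N_B(\varepsilon)$ is the minimal number of open balls of radius $\varepsilon$ covering $B$. Separability of the process is with respect to $(T,\rho)$. If the right-hand side is infinite the inequality is regarded as trivially true.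
   Formalization: For arbitrary c the bound can fail for the pointwise supremum; it is proved for the supremum modulo a.s. equality, which is shown to be the pointwise one if X is separable on each B_k or cX is separable on T. *)

theory Defs
  imports "HOL-Probability.Probability"
begin

section \<open>Quasinormed lattices of random variables\<close>

text \<open>A space of random variables is represented by the set \<open>K\<close> of all representatives of its
  elements; random variables are identified when they agree almost surely, which is the last
  clause below.\<close>

definition rv_space :: "'w measure \<Rightarrow> ('w \<Rightarrow> real) set \<Rightarrow> bool" where
  "rv_space M K \<longleftrightarrow>
     K \<subseteq> borel_measurable M \<and>
     (\<lambda>\<omega>. 0) \<in> K \<and>
     (\<forall>\<xi>\<in>K. \<forall>\<eta>\<in>K. (\<lambda>\<omega>. \<xi> \<omega> + \<eta> \<omega>) \<in> K) \<and>
     (\<forall>\<xi>\<in>K. \<forall>r. (\<lambda>\<omega>. r * \<xi> \<omega>) \<in> K) \<and>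
     (\<forall>\<xi>\<in>K. \<forall>\<eta>\<in>borel_measurable M. (AE \<omega> in M. \<eta> \<omega> = \<xi> \<omega>) \<longrightarrow> \<eta> \<in> K)"

definition quasinorm :: "'w measure \<Rightarrow> ('w \<Rightarrow> real) set \<Rightarrow> (('w \<Rightarrow> real) \<Rightarrow> real) \<Rightarrow> bool" where
  "quasinorm M K nrm \<longleftrightarrow>
     (\<forall>\<xi>\<in>K. 0 \<le> nrm \<xi>) \<and>
     (\<forall>\<xi>\<in>K. nrm \<xi> = 0 \<longleftrightarrow> (AE \<omega> in M. \<xi> \<omega> = 0)) \<and>
     (\<forall>\<xi>\<in>K. \<forall>\<eta>\<in>K. nrm (\<lambda>\<omega>. \<xi> \<omega> + \<eta> \<omega>) \<le> nrm \<xi> + nrm \<eta>) \<and>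
     (\<forall>\<xi>\<in>K. \<forall>r. \<bar>r\<bar> \<le> 1 \<longrightarrow> nrm (\<lambda>\<omega>. r * \<xi> \<omega>) \<le> nrm \<xi>)"

definition quasinorm_complete :: "('w \<Rightarrow> real) set \<Rightarrow> (('w \<Rightarrow> real) \<Rightarrow> real) \<Rightarrow> bool" where
  "quasinorm_complete K nrm \<longleftrightarrow>
     (\<forall>\<xi> :: nat \<Rightarrow> 'w \<Rightarrow> real.
        (\<forall>n. \<xi> n \<in> K) \<and>
        (\<forall>e>0. \<exists>n0. \<forall>m\<ge>n0. \<forall>n\<ge>n0. nrm (\<lambda>\<omega>. \<xi> m \<omega> - \<xi> n \<omega>) < e) \<longrightarrow>
        (\<exists>\<eta>\<in>K. (\<lambda>n. nrm (\<lambda>\<omega>. \<xi> n \<omega> - \<eta> \<omega>)) \<longlonglongrightarrow> 0))"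

definition quasi_banach :: "'w measure \<Rightarrow> ('w \<Rightarrow> real) set \<Rightarrow> (('w \<Rightarrow> real) \<Rightarrow> real) \<Rightarrow> bool" where
  "quasi_banach M K nrm \<longleftrightarrow> rv_space M K \<and> quasinorm M K nrm \<and> quasinorm_complete K nrm"

definition quasi_K_sigma_space ::
  "'w measure \<Rightarrow> ('w \<Rightarrow> real) set \<Rightarrow> (('w \<Rightarrow> real) \<Rightarrow> real) \<Rightarrow> bool" where
  "quasi_K_sigma_space M K nrm \<longleftrightarrow>
     quasi_banach M K nrm \<and>
     (\<forall>\<xi>\<in>K. \<forall>\<eta>\<in>K. (\<lambda>\<omega>. max (\<xi> \<omega>) (\<eta> \<omega>)) \<in> K \<and> (\<lambda>\<omega>. min (\<xi> \<omega>) (\<eta> \<omega>)) \<in> K) \<and>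
     (\<forall>\<xi>\<in>K. \<forall>\<eta>\<in>K. (AE \<omega> in M. \<bar>\<xi> \<omega>\<bar> \<le> \<bar>\<eta> \<omega>\<bar>) \<longrightarrow> nrm \<xi> \<le> nrm \<eta>) \<and>
     (\<forall>\<xi> :: nat \<Rightarrow> 'w \<Rightarrow> real. \<forall>\<eta>\<in>K.
        (\<forall>n. \<xi> n \<in> K) \<and> (AE \<omega> in M. \<forall>n. \<bar>\<xi> n \<omega>\<bar> \<le> \<eta> \<omega>) \<longrightarrow>
        (\<lambda>\<omega>. SUP n. \<bar>\<xi> n \<omega>\<bar>) \<in> K)"

definition subordinate_to ::
  "('w \<Rightarrow> real) set \<Rightarrow> (('w \<Rightarrow> real) \<Rightarrow> real) \<Rightarrow> (real \<Rightarrow> real) \<Rightarrow> bool" where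
  "subordinate_to K nrm j \<longleftrightarrow>
     (\<forall>x\<in>{0..1}. 0 \<le> j x) \<and> mono_on {0..1} j \<and> (j \<longlongrightarrow> 0) (at 0 within {0..1}) \<and>
     (\<forall>\<xi>\<in>K. \<forall>r. \<bar>r\<bar> \<le> 1 \<longrightarrow> nrm (\<lambda>\<omega>. r * \<xi> \<omega>) \<le> j \<bar>r\<bar> * nrm \<xi>)"

definition majorizing_characteristic ::
  "('w \<Rightarrow> real) set \<Rightarrow> (('w \<Rightarrow> real) \<Rightarrow> real) \<Rightarrow> (nat \<Rightarrow> real) \<Rightarrow> bool" where
  "majorizing_characteristic K nrm \<mu> \<longleftrightarrow>
     mono_on {1..} \<mu> \<and>
     (\<forall>n\<ge>1. \<forall>\<xi> :: nat \<Rightarrow> 'w \<Rightarrow> real. (\<forall>i\<in>{1..n}. \<xi> i \<in> K) \<longrightarrow>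
        nrm (\<lambda>\<omega>. MAX i\<in>{1..n}. \<bar>\<xi> i \<omega>\<bar>) \<le> \<mu> n * (MAX i\<in>{1..n}. nrm (\<xi> i)))"


section \<open>Pseudometric spaces\<close>

definition pseudometric_on :: "'t set \<Rightarrow> ('t \<Rightarrow> 't \<Rightarrow> real) \<Rightarrow> bool" where
  "pseudometric_on T \<rho> \<longleftrightarrow>
     (\<forall>x\<in>T. \<forall>y\<in>T. 0 \<le> \<rho> x y \<and> \<rho> x y = \<rho> y x) \<and>
     (\<forall>x\<in>T. \<rho> x x = 0) \<and>
     (\<forall>x\<in>T. \<forall>y\<in>T. \<forall>z\<in>T. \<rho> x z \<le> \<rho> x y + \<rho> y z)"

definition pm_topology :: "'t set \<Rightarrow> ('t \<Rightarrow> 't \<Rightarrow> real) \<Rightarrow> 't topology" where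
  "pm_topology T \<rho> =
     topology (\<lambda>U. U \<subseteq> T \<and> (\<forall>x\<in>U. \<exists>r>0. \<forall>y\<in>T. \<rho> x y < r \<longrightarrow> y \<in> U))"

lemma istopology_pm:
  "istopology (\<lambda>U. U \<subseteq> T \<and> (\<forall>x\<in>U. \<exists>r>0::real. \<forall>y\<in>T. \<rho> x y < r \<longrightarrow> y \<in> U))"
  unfolding istopology_def
proof (intro conjI allI impI)
  fix U V
  assume U: "U \<subseteq> T \<and> (\<forall>x\<in>U. \<exists>r>0::real. \<forall>y\<in>T. \<rho> x y < r \<longrightarrow> y \<in> U)"
    and V: "V \<subseteq> T \<and> (\<forall>x\<in>V. \<exists>r>0::real. \<forall>y\<in>T. \<rho> x y < r \<longrightarrow> y \<in> V)"
  show "U \<inter> V \<subseteq> T" using U by blast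
  show "\<forall>x\<in>U \<inter> V. \<exists>r>0::real. \<forall>y\<in>T. \<rho> x y < r \<longrightarrow> y \<in> U \<inter> V"
  proof
    fix x assume x: "x \<in> U \<inter> V"
    obtain r where r: "r > 0" "\<And>y. y \<in> T \<Longrightarrow> \<rho> x y < r \<Longrightarrow> y \<in> U"
      using U IntD1[OF x] by meson
    obtain s where s: "s > 0" "\<And>y. y \<in> T \<Longrightarrow> \<rho> x y < s \<Longrightarrow> y \<in> V"
      using V IntD2[OF x] by meson
    show "\<exists>r>0::real. \<forall>y\<in>T. \<rho> x y < r \<longrightarrow> y \<in> U \<inter> V"
      by (rule exI[of _ "min r s"]) (simp add: r s)
  qed
next
  fix \<A>
  assume A: "\<forall>U\<in>\<A>. U \<subseteq> T \<and> (\<forall>x\<in>U. \<exists>r>0::real. \<forall>y\<in>T. \<rho> x y < r \<longrightarrow> y \<in> U)"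
  show "\<Union>\<A> \<subseteq> T"
    by (rule Union_least) (use A in simp)
  show "\<forall>x\<in>\<Union>\<A>. \<exists>r>0::real. \<forall>y\<in>T. \<rho> x y < r \<longrightarrow> y \<in> \<Union>\<A>"
  proof
    fix x assume "x \<in> \<Union>\<A>"
    then obtain U where U: "U \<in> \<A>" "x \<in> U" by (rule UnionE)
    then obtain r where r: "r > 0" "\<And>y. y \<in> T \<Longrightarrow> \<rho> x y < r \<Longrightarrow> y \<in> U"
      using A by meson
    show "\<exists>r>0::real. \<forall>y\<in>T. \<rho> x y < r \<longrightarrow> y \<in> \<Union>\<A>"
      by (rule exI[of _ r]) (use r U(1) in auto)
  qed
qed

lemma openin_pm_topology:
  "openin (pm_topology T \<rho>) U \<longleftrightarrow> U \<subseteq> T \<and> (\<forall>x\<in>U. \<exists>r>0. \<forall>y\<in>T. \<rho> x y < r \<longrightarrow> y \<in> U)"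
  unfolding pm_topology_def topology_inverse'[OF istopology_pm] by (rule refl)

lemma topspace_pm_topology [simp]: "topspace (pm_topology T \<rho>) = T"
proof (rule antisym)
  have "openin (pm_topology T \<rho>) (topspace (pm_topology T \<rho>))"
    by (rule openin_topspace)
  then show "topspace (pm_topology T \<rho>) \<subseteq> T"
    unfolding openin_pm_topology by (rule conjunct1)
  have "\<exists>r>0. \<forall>y\<in>T. \<rho> x y < r \<longrightarrow> y \<in> T" for x
    by (rule exI[of _ 1]) simp
  then have "openin (pm_topology T \<rho>) T"
    unfolding openin_pm_topology by simp
  then show "T \<subseteq> topspace (pm_topology T \<rho>)"
    by (rule openin_subset)
qed

text \<open>The balls are those of the space \<open>(B, \<rho>)\<close>, i.e. they are centred in \<open>B\<close>.  The value is
  \<open>\<infinity>\<close> if no finite cover exists; for nonempty compact \<open>B\<close> this happens only for \<open>\<epsilon> \<le> 0\<close>.\<close>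

definition covering_number :: "('t \<Rightarrow> 't \<Rightarrow> real) \<Rightarrow> 't set \<Rightarrow> real \<Rightarrow> enat" where
  "covering_number \<rho> B \<epsilon> =
     Inf {enat (card C) | C. finite C \<and> C \<subseteq> B \<and> B \<subseteq> (\<Union>x\<in>C. {y. \<rho> x y < \<epsilon>})}"

text \<open>The least radius of a closed ball centred in \<open>B\<close> that contains \<open>B\<close>.\<close>

definition is_central_radius :: "('t \<Rightarrow> 't \<Rightarrow> real) \<Rightarrow> 't set \<Rightarrow> real \<Rightarrow> bool" where
  "is_central_radius \<rho> B r \<longleftrightarrow>
     (\<exists>t0\<in>B. \<forall>t\<in>B. \<rho> t t0 \<le> r) \<and>
     (\<forall>r'. (\<exists>t0\<in>B. \<forall>t\<in>B. \<rho> t t0 \<le> r') \<longrightarrow> r \<le> r')"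


section \<open>Separable processes and their suprema\<close>

text \<open>Doob separability with respect to closed sets of values.\<close>

definition separable_process ::
  "'w measure \<Rightarrow> 't set \<Rightarrow> ('t \<Rightarrow> 't \<Rightarrow> real) \<Rightarrow> ('t \<Rightarrow> 'w \<Rightarrow> real) \<Rightarrow> bool" where
  "separable_process M T \<rho> X \<longleftrightarrow>
     (\<exists>S N. countable S \<and> S \<subseteq> T \<and> pm_topology T \<rho> closure_of S = T \<and> N \<in> null_sets M \<and>
        (\<forall>\<omega>\<in>space M - N. \<forall>U F. openin (pm_topology T \<rho>) U \<and> closed F \<and>
           (\<forall>s\<in>S \<inter> U. X s \<omega> \<in> F) \<longrightarrow> (\<forall>t\<in>U. X t \<omega> \<in> F)))"

text \<open>The supremum of a family of random variables in the lattice of random variables modulo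
  almost sure equality.  For a discontinuous weight \<open>c\<close>, separability of \<open>X\<close> on the whole of \<open>T\<close>
  does not make the pointwise supremum of \<open>\<bar>c t * X t\<bar>\<close> agree with it: the paths of \<open>X\<close> on a
  set \<open>B k\<close> with empty interior are then controlled only by values of \<open>X\<close> outside \<open>B k\<close>, where
  \<open>c\<close> may be arbitrarily small.\<close>

definition is_lattice_sup ::
  "'w measure \<Rightarrow> 't set \<Rightarrow> ('t \<Rightarrow> 'w \<Rightarrow> real) \<Rightarrow> ('w \<Rightarrow> real) \<Rightarrow> bool" where
  "is_lattice_sup M T Y \<xi> \<longleftrightarrow>
     \<xi> \<in> borel_measurable M \<and>
     (\<forall>t\<in>T. AE \<omega> in M. Y t \<omega> \<le> \<xi> \<omega>) \<and>
     (\<forall>\<zeta>\<in>borel_measurable M. (\<forall>t\<in>T. AE \<omega> in M. Y t \<omega> \<le> \<zeta> \<omega>) \<longrightarrow> (AE \<omega> in M. \<xi> \<omega> \<le> \<zeta> \<omega>))"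

definition is_pointwise_sup ::
  "'w measure \<Rightarrow> 't set \<Rightarrow> ('t \<Rightarrow> 'w \<Rightarrow> real) \<Rightarrow> ('w \<Rightarrow> real) \<Rightarrow> bool" where
  "is_pointwise_sup M T Y \<xi> \<longleftrightarrow>
     (AE \<omega> in M. bdd_above ((\<lambda>t. Y t \<omega>) ` T) \<and> \<xi> \<omega> = (SUP t\<in>T. Y t \<omega>))"

text \<open>A continuous weight preserves separability.  A discontinuous one need not.\<close>

lemma separable_process_weight:
  assumes X: "separable_process M T \<rho> X"
    and c: "continuous_map (pm_topology T \<rho>) euclideanreal c"
  shows "separable_process M T \<rho> (\<lambda>t \<omega>. c t * X t \<omega>)"
proof -
  let ?O = "openin (pm_topology T \<rho>)"
  obtain S N where S: "countable S" "S \<subseteq> T" "pm_topology T \<rho> closure_of S = T" "N \<in> null_sets M"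
    and sep: "\<And>\<omega> U F. \<omega> \<in> space M - N \<Longrightarrow> ?O U \<Longrightarrow> closed F \<Longrightarrow> \<forall>s\<in>S \<inter> U. X s \<omega> \<in> F \<Longrightarrow>
       \<forall>t\<in>U. X t \<omega> \<in> F"
    using X unfolding separable_process_def by meson
  have "c t * X t \<omega> \<in> F"
    if \<omega>: "\<omega> \<in> space M - N" and U: "?O U" and F: "closed F"
      and inF: "\<forall>s\<in>S \<inter> U. c s * X s \<omega> \<in> F" and t: "t \<in> U" for \<omega> U F t
  proof (rule ccontr)
    assume "c t * X t \<omega> \<notin> F"
    moreover have "open ((\<lambda>p. fst p * snd p) -` (- F) :: (real \<times> real) set)"
      using F by (intro open_vimage continuous_intros) auto
    moreover from calculation have "(c t, X t \<omega>) \<in> (\<lambda>p. fst p * snd p) -` (- F)"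
      by simp
    ultimately obtain A B where AB: "open A" "open B" "(c t, X t \<omega>) \<in> A \<times> B"
      and sub: "A \<times> B \<subseteq> (\<lambda>p. fst p * snd p) -` (- F)"
      by (elim open_prod_elim)
    let ?V = "U \<inter> {x \<in> topspace (pm_topology T \<rho>). c x \<in> A}"
    have V: "?O ?V"
      by (rule openin_Int[OF U openin_continuous_map_preimage[OF c]]) (use AB(1) in simp)
    have "t \<in> ?V"
      using t AB(3) openin_subset[OF U] by blast
    then have "\<not> (\<forall>s\<in>S \<inter> ?V. X s \<omega> \<in> - B)"
      using sep[OF \<omega> V, of "- B"] AB(2,3) by (simp only: closed_Compl) blast
    then obtain s where "s \<in> S \<inter> U" "c s \<in> A" "X s \<omega> \<in> B"
      by blast
    moreover from this have "(c s, X s \<omega>) \<in> (\<lambda>p. fst p * snd p) -` (- F)"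
      using sub by (simp add: subset_iff)
    ultimately show False
      using inF by simp
  qed
  then have "\<forall>\<omega>\<in>space M - N. \<forall>U F. ?O U \<and> closed F \<and> (\<forall>s\<in>S \<inter> U. c s * X s \<omega> \<in> F) \<longrightarrow>
      (\<forall>t\<in>U. c t * X t \<omega> \<in> F)"
    by (intro ballI allI impI) (elim conjE)
  with S show ?thesis
    unfolding separable_process_def by (intro exI[of _ S] exI[of _ N] conjI)
qed


section \<open>The bound\<close>

text \<open>The value of \<open>\<mu>\<close> at a possibly infinite covering number.  A majorizing characteristic of a
  space with a nonzero element satisfies \<open>\<mu> n \<ge> 1\<close> for \<open>n \<ge> 1\<close>, so that \<^const>\<open>ennreal\<close> does
  not truncate it.\<close>

definition mu_at :: "(nat \<Rightarrow> real) \<Rightarrow> enat \<Rightarrow> ennreal" where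
  "mu_at \<mu> N = (case N of enat n \<Rightarrow> ennreal (\<mu> n) | \<infinity> \<Rightarrow> \<infinity>)"

text \<open>The products below follow the convention \<open>0 * \<infinity> = 0\<close> of \<^typ>\<open>ennreal\<close>.\<close>

definition chaining_bound ::
  "(('w \<Rightarrow> real) \<Rightarrow> real) \<Rightarrow> (nat \<Rightarrow> real) \<Rightarrow> (real \<Rightarrow> real) \<Rightarrow> ('t \<Rightarrow> 't \<Rightarrow> real) \<Rightarrow>
   ('t \<Rightarrow> 'w \<Rightarrow> real) \<Rightarrow> 't set \<Rightarrow> (nat \<Rightarrow> real) \<Rightarrow> ennreal" where
  "chaining_bound nrm \<mu> \<sigma> \<rho> X B \<epsilon> =
     (SUP t\<in>B. ennreal (nrm (X t))) +
     (\<Sum>l. mu_at \<mu> (covering_number \<rho> B (\<epsilon> (Suc l))) * ennreal (\<sigma> (\<epsilon> l)))"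

end

theory Submission
  imports Defs
begin

text \<open>
  The proof is by chaining on each compact set \<open>B k\<close>, followed by summation over \<open>k\<close>.

  On a compact set \<open>B\<close> with finite chaining bound, every \<open>X t\<close> is reached from the centre \<open>t0\<close> through
  increments between consecutive nets.  The maximum of the increments at level \<open>l\<close> has quasinorm at
  most \<open>\<mu> (N (\<epsilon> (l + 1))) * \<sigma> (\<epsilon> l)\<close>.  Completeness and monotonicity of the quasinorm give an
  element of \<open>K\<close> that dominates the sum of these maxima, with quasinorm at most the sum of the bounds
  (\<open>series_dominated\<close>).  Hence some \<open>\<eta> \<in> K\<close> dominates \<open>\<bar>X t\<bar>\<close> for every \<open>t \<in> B\<close> and has quasinorm at
  most the chaining bound (\<open>chaining\<close>).  Multiplication by \<open>\<gamma>\<close>, an upper bound for \<open>\<bar>c t\<bar>\<close>, brings in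
  the factor \<open>j \<gamma>\<close> (\<open>weighted_bound\<close>), and a further series over \<open>k\<close> gives an element of \<open>K\<close> that
  dominates all \<open>\<bar>c t * X t\<bar>\<close> and satisfies the asserted bound.

  It remains to find the supremum \<open>\<xi>\<close> itself.  It is the pointwise supremum over a countable set \<open>D\<close>,
  which belongs to \<open>K\<close> by the lattice axiom for countable suprema.  For \<open>\<xi>\<close> to dominate
  \<open>\<bar>c t * X t\<bar>\<close> at every other \<open>t\<close>, the set \<open>D\<close> is chosen such that every \<open>t \<in> B k\<close> is a limit of
  points \<open>d \<in> D\<close> of \<open>B k\<close> with \<open>c d\<close> tending to \<open>c t\<close> (\<open>countable_weight_dense\<close>), and \<open>X d\<close> has to
  tend to \<open>X t\<close> almost surely along such points.  The latter holds because a finite chaining bound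
  yields more than boundedness: the remainders of the chaining are small, and all increments over
  small distances are dominated by a single variable of small quasinorm
  (\<open>oscillation_dominated\<close>).  This almost sure modulus of continuity also
  identifies \<open>\<xi>\<close> with the pointwise supremum when \<open>X\<close> is separable on each \<open>B k\<close>.  When instead the
  weighted process is separable, the pointwise supremum is controlled by the values on a countable
  separating set, each of which is dominated by \<open>\<xi>\<close>.
\<close>


section \<open>Quasinormed lattices\<close>

locale quasi_K_sigma =
  fixes M :: "'w measure" and K :: "('w \<Rightarrow> real) set" and nrm :: "('w \<Rightarrow> real) \<Rightarrow> real"
  assumes space: "quasi_K_sigma_space M K nrm"
begin

lemma rv: "rv_space M K" and qn: "quasinorm M K nrm" and complete: "quasinorm_complete K nrm"
  using space unfolding quasi_K_sigma_space_def quasi_banach_def by auto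

lemma K_measurable: "\<xi> \<in> K \<Longrightarrow> \<xi> \<in> borel_measurable M"
  and K_zero: "(\<lambda>\<omega>. 0) \<in> K"
  and K_add: "\<xi> \<in> K \<Longrightarrow> \<eta> \<in> K \<Longrightarrow> (\<lambda>\<omega>. \<xi> \<omega> + \<eta> \<omega>) \<in> K"
  and K_scale: "\<xi> \<in> K \<Longrightarrow> (\<lambda>\<omega>. r * \<xi> \<omega>) \<in> K"
  using rv unfolding rv_space_def by auto

lemma K_max: "\<xi> \<in> K \<Longrightarrow> \<eta> \<in> K \<Longrightarrow> (\<lambda>\<omega>. max (\<xi> \<omega>) (\<eta> \<omega>)) \<in> K"
  and nrm_mono: "\<xi> \<in> K \<Longrightarrow> \<eta> \<in> K \<Longrightarrow> (AE \<omega> in M. \<bar>\<xi> \<omega>\<bar> \<le> \<bar>\<eta> \<omega>\<bar>) \<Longrightarrow> nrm \<xi> \<le> nrm \<eta>"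
  using space unfolding quasi_K_sigma_space_def by auto

lemma K_SUP:
  fixes \<theta> :: "nat \<Rightarrow> 'w \<Rightarrow> real"
  assumes "\<And>n. \<theta> n \<in> K" "\<eta> \<in> K" "AE \<omega> in M. \<forall>n. \<bar>\<theta> n \<omega>\<bar> \<le> \<eta> \<omega>"
  shows "(\<lambda>\<omega>. SUP n. \<bar>\<theta> n \<omega>\<bar>) \<in> K"
proof -
  have "\<forall>\<theta> :: nat \<Rightarrow> 'w \<Rightarrow> real. \<forall>\<eta>\<in>K.
        (\<forall>n. \<theta> n \<in> K) \<and> (AE \<omega> in M. \<forall>n. \<bar>\<theta> n \<omega>\<bar> \<le> \<eta> \<omega>) \<longrightarrow> (\<lambda>\<omega>. SUP n. \<bar>\<theta> n \<omega>\<bar>) \<in> K"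
    using space unfolding quasi_K_sigma_space_def by (elim conjE)
  from this[rule_format, OF assms(2), of \<theta>] assms(1,3) show ?thesis
    by (simp only: simp_thms)
qed

lemma nrm_nonneg: "\<xi> \<in> K \<Longrightarrow> 0 \<le> nrm \<xi>"
  and nrm_eq_0_iff: "\<xi> \<in> K \<Longrightarrow> nrm \<xi> = 0 \<longleftrightarrow> (AE \<omega> in M. \<xi> \<omega> = 0)"
  and nrm_triangle: "\<xi> \<in> K \<Longrightarrow> \<eta> \<in> K \<Longrightarrow> nrm (\<lambda>\<omega>. \<xi> \<omega> + \<eta> \<omega>) \<le> nrm \<xi> + nrm \<eta>"
  using qn unfolding quasinorm_def by auto

lemma K_diff: "\<xi> \<in> K \<Longrightarrow> \<eta> \<in> K \<Longrightarrow> (\<lambda>\<omega>. \<xi> \<omega> - \<eta> \<omega>) \<in> K"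
  using K_add[of \<xi> "\<lambda>\<omega>. -1 * \<eta> \<omega>"] K_scale[of \<eta> "-1"] by simp

lemma K_abs: "\<xi> \<in> K \<Longrightarrow> (\<lambda>\<omega>. \<bar>\<xi> \<omega>\<bar>) \<in> K"
proof -
  have "\<bar>x\<bar> = max x (- x)" for x :: real
    by auto
  then show "\<xi> \<in> K \<Longrightarrow> (\<lambda>\<omega>. \<bar>\<xi> \<omega>\<bar>) \<in> K"
    using K_max[of \<xi> "\<lambda>\<omega>. -1 * \<xi> \<omega>"] K_scale[of \<xi> "-1"] by simp
qed

lemma nrm_abs: "\<xi> \<in> K \<Longrightarrow> nrm (\<lambda>\<omega>. \<bar>\<xi> \<omega>\<bar>) = nrm \<xi>"
  by (intro antisym nrm_mono K_abs) auto

lemma nrm_minus_commute: "\<xi> \<in> K \<Longrightarrow> \<eta> \<in> K \<Longrightarrow> nrm (\<lambda>\<omega>. \<xi> \<omega> - \<eta> \<omega>) = nrm (\<lambda>\<omega>. \<eta> \<omega> - \<xi> \<omega>)"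
  by (intro antisym nrm_mono K_diff) auto

lemma nrm_zero: "nrm (\<lambda>\<omega>. 0) = 0"
  using nrm_eq_0_iff[OF K_zero] by simp

lemma K_sum: "(\<And>i. i \<in> A \<Longrightarrow> f i \<in> K) \<Longrightarrow> (\<lambda>\<omega>. \<Sum>i\<in>A. f i \<omega>) \<in> K"
  by (induction A rule: infinite_finite_induct) (auto intro: K_zero K_add)

lemma nrm_sum: "(\<And>i. i \<in> A \<Longrightarrow> f i \<in> K) \<Longrightarrow> nrm (\<lambda>\<omega>. \<Sum>i\<in>A. f i \<omega>) \<le> (\<Sum>i\<in>A. nrm (f i))"
proof (induction A rule: infinite_finite_induct)
  case (insert a A)
  then show ?case
    using nrm_triangle[of "f a" "\<lambda>\<omega>. \<Sum>i\<in>A. f i \<omega>"] K_sum[of A f] by fastforce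
qed (simp_all add: nrm_zero)

lemma K_Max:
  assumes "finite A" "A \<noteq> {}" "\<And>i. i \<in> A \<Longrightarrow> f i \<in> K"
  shows "(\<lambda>\<omega>. MAX i\<in>A. f i \<omega>) \<in> K"
  using assms by (induction A rule: finite_ne_induct) (auto intro: K_max)

text \<open>The positive part of \<open>f - g\<close> lies in \<open>K\<close> and has arbitrarily small quasinorm, hence vanishes
  almost surely.  This is how convergence in quasinorm is turned into almost sure inequalities:
  it replaces the passage to an almost surely convergent subsequence.\<close>

lemma AE_le_of_small_excess:
  assumes f: "f \<in> K" and g: "g \<in> K"
    and small: "\<And>e. e > 0 \<Longrightarrow> \<exists>h\<in>K. nrm h < e \<and> (AE \<omega> in M. f \<omega> \<le> g \<omega> + h \<omega>)"
  shows "AE \<omega> in M. f \<omega> \<le> g \<omega>"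
proof -
  let ?z = "\<lambda>\<omega>. max (f \<omega> - g \<omega>) 0"
  have z: "?z \<in> K"
    by (intro K_max K_diff K_zero f g)
  have "nrm ?z < e" if "e > 0" for e :: real
  proof -
    obtain h where h: "h \<in> K" "nrm h < e" "AE \<omega> in M. f \<omega> \<le> g \<omega> + h \<omega>"
      using small[OF \<open>e > 0\<close>] by (elim bexE conjE)
    have "nrm ?z \<le> nrm h"
      by (rule nrm_mono[OF z h(1)]) (use h(3) in eventually_elim, auto)
    with h(2) show ?thesis by simp
  qed
  then have "nrm ?z \<le> 0"
    using dense_ge[of 0 "nrm ?z"] less_imp_le by metis
  then have "AE \<omega> in M. ?z \<omega> = 0"
    using nrm_eq_0_iff[OF z] nrm_nonneg[OF z] by simp
  then show ?thesis
    by eventually_elim (simp add: max_def split: if_splits)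
qed

text \<open>Completeness provides a quasinorm limit \<open>\<eta>\<close> of the partial sums.  Since these increase,
  each of them exceeds \<open>\<eta>\<close> by at most a quantity of vanishing quasinorm, so \<open>\<eta>\<close> dominates them all.
  Its quasinorm is bounded through the triangle inequality for \<open>\<eta>\<close> and a late partial sum.\<close>

lemma series_dominated:
  assumes \<xi>: "\<And>n. \<xi> n \<in> K" and nonneg: "\<And>n \<omega>. 0 \<le> \<xi> n \<omega>"
    and fin: "(\<Sum>n. ennreal (nrm (\<xi> n))) < \<infinity>"
  shows "\<exists>\<eta>\<in>K. ennreal (nrm \<eta>) \<le> (\<Sum>n. ennreal (nrm (\<xi> n))) \<and>
    (AE \<omega> in M. \<forall>n. (\<Sum>i<n. \<xi> i \<omega>) \<le> \<eta> \<omega>)"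
proof -
  let ?a = "\<lambda>n. nrm (\<xi> n)"
  have a0: "0 \<le> ?a n" for n
    by (rule nrm_nonneg[OF \<xi>])
  have sm: "summable ?a"
    using fin by (intro summable_suminf_not_top a0) auto
  define S where "S n = (\<lambda>\<omega>. \<Sum>i<n. \<xi> i \<omega>)" for n :: nat
  have S: "S n \<in> K" for n
    unfolding S_def by (intro K_sum \<xi>)
  have tail: "nrm (\<lambda>\<omega>. S m \<omega> - S n \<omega>) \<le> sum ?a {n..<m}" if "n \<le> m" for m n
  proof -
    have "S m \<omega> - S n \<omega> = (\<Sum>i\<in>{n..<m}. \<xi> i \<omega>)" for \<omega>
      using sum_diff_nat_ivl[of 0 n m "\<lambda>i. \<xi> i \<omega>"] that
      by (simp add: S_def lessThan_atLeast0)
    then show ?thesis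
      by (simp only:) (rule nrm_sum[OF \<xi>])
  qed
  have "\<exists>n0. \<forall>m\<ge>n0. \<forall>n\<ge>n0. nrm (\<lambda>\<omega>. S m \<omega> - S n \<omega>) < e" if e: "e > 0" for e
  proof -
    obtain N where N: "\<And>m n. m \<ge> N \<Longrightarrow> norm (sum ?a {m..<n}) < e"
      using sm e unfolding summable_Cauchy by blast
    have *: "nrm (\<lambda>\<omega>. S m \<omega> - S n \<omega>) < e" if "n \<ge> N" "n \<le> m" for m n
      using tail[OF that(2)] N[OF that(1), of m] by simp
    show ?thesis
    proof (intro exI[of _ N] allI impI)
      fix m n assume "N \<le> m" "N \<le> n"
      then show "nrm (\<lambda>\<omega>. S m \<omega> - S n \<omega>) < e"
        using *[of n m] *[of m n] nrm_minus_commute[OF S S, of m n] by (cases "n \<le> m") auto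
    qed
  qed
  then have "\<exists>\<eta>\<in>K. (\<lambda>n. nrm (\<lambda>\<omega>. S n \<omega> - \<eta> \<omega>)) \<longlonglongrightarrow> 0"
    by (intro complete[unfolded quasinorm_complete_def, THEN spec, of S, THEN mp] conjI allI impI S)
  then obtain \<eta> where \<eta>: "\<eta> \<in> K" and lim: "(\<lambda>n. nrm (\<lambda>\<omega>. S n \<omega> - \<eta> \<omega>)) \<longlonglongrightarrow> 0"
    by (elim bexE)
  have "AE \<omega> in M. S n \<omega> \<le> \<eta> \<omega>" for n
  proof (rule AE_le_of_small_excess[OF S \<eta>])
    fix e :: real assume "e > 0"
    then have "eventually (\<lambda>m. nrm (\<lambda>\<omega>. S m \<omega> - \<eta> \<omega>) < e) sequentially"
      by (rule order_tendstoD[OF lim])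
    then have "eventually (\<lambda>m. m \<ge> n \<and> nrm (\<lambda>\<omega>. S m \<omega> - \<eta> \<omega>) < e) sequentially"
      by (intro eventually_conj eventually_ge_at_top)
    then obtain m where m: "m \<ge> n" "nrm (\<lambda>\<omega>. S m \<omega> - \<eta> \<omega>) < e"
      by (elim eventually_happens'[OF sequentially_bot, elim_format] exE conjE)
    have "S n \<omega> \<le> S m \<omega>" for \<omega>
      unfolding S_def by (rule sum_mono2) (use m nonneg in auto)
    then have "AE \<omega> in M. S n \<omega> \<le> \<eta> \<omega> + (S m \<omega> - \<eta> \<omega>)"
      by simp
    then show "\<exists>h\<in>K. nrm h < e \<and> (AE \<omega> in M. S n \<omega> \<le> \<eta> \<omega> + h \<omega>)"
      using m(2) K_diff[OF S[of m] \<eta>] by (intro bexI conjI)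
  qed
  then have dom: "AE \<omega> in M. \<forall>n. S n \<omega> \<le> \<eta> \<omega>"
    by (simp add: AE_all_countable)
  have le: "nrm \<eta> \<le> suminf ?a + nrm (\<lambda>\<omega>. S n \<omega> - \<eta> \<omega>)" for n
  proof -
    have "nrm \<eta> \<le> nrm (S n) + nrm (\<lambda>\<omega>. \<eta> \<omega> - S n \<omega>)"
      using nrm_triangle[OF S K_diff[OF \<eta> S], of n n] by simp
    also have "nrm (S n) \<le> suminf ?a"
      unfolding S_def using a0 by (intro order_trans[OF nrm_sum[OF \<xi>]] sum_le_suminf[OF sm]) auto
    finally show ?thesis
      by (simp add: nrm_minus_commute[OF S \<eta>])
  qed
  have lim': "(\<lambda>n. suminf ?a + nrm (\<lambda>\<omega>. S n \<omega> - \<eta> \<omega>)) \<longlonglongrightarrow> suminf ?a"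
    using tendsto_add[OF tendsto_const lim, of "suminf ?a"] by (simp only: add_0_right)
  have "nrm \<eta> \<le> suminf ?a"
    by (rule LIMSEQ_le_const[OF lim']) (intro exI allI impI le)
  then have "ennreal (nrm \<eta>) \<le> (\<Sum>n. ennreal (?a n))"
    using suminf_ennreal2[OF a0 sm] by (simp add: ennreal_leI)
  with \<eta> dom show ?thesis
    unfolding S_def by (intro bexI[of _ \<eta>] conjI)
qed

text \<open>A bijection with an initial segment of the natural numbers reduces the claim to the definition.  If \<open>\<mu>\<close> is negative at the relevant
  argument, the quasinorm on the left is zero, so the truncation by \<^const>\<open>ennreal\<close> does no harm.\<close>

lemma majorizing_finite:
  assumes \<mu>: "majorizing_characteristic K nrm \<mu>"
    and A: "finite A" "A \<noteq> {}" and f: "\<And>u. u \<in> A \<Longrightarrow> f u \<in> K" and r: "\<And>u. u \<in> A \<Longrightarrow> nrm (f u) \<le> r"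
  shows "ennreal (nrm (\<lambda>\<omega>. MAX u\<in>A. \<bar>f u \<omega>\<bar>)) \<le> ennreal (\<mu> (card A)) * ennreal r"
proof -
  obtain g where g: "bij_betw g {1..card A} A"
    using ex_bij_betw_nat_finite_1[OF A(1)] by (elim exE)
  have n: "card A \<ge> 1"
    using A by (simp add: Suc_le_eq card_gt_0_iff)
  have im: "g ` {1..card A} = A"
    using g by (rule bij_betw_imp_surj_on)
  have gA: "i \<in> {1..card A} \<Longrightarrow> g i \<in> A" for i
    using im by blast
  have im_comp: "(\<lambda>i. h (g i)) ` {1..card A} = h ` A" for h :: "_ \<Rightarrow> real"
    using image_image[of h g "{1..card A}"] im by simp
  have "\<forall>n\<ge>1. \<forall>\<xi> :: nat \<Rightarrow> 'w \<Rightarrow> real. (\<forall>i\<in>{1..n}. \<xi> i \<in> K) \<longrightarrow>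
        nrm (\<lambda>\<omega>. MAX i\<in>{1..n}. \<bar>\<xi> i \<omega>\<bar>) \<le> \<mu> n * (MAX i\<in>{1..n}. nrm (\<xi> i))"
    using \<mu> unfolding majorizing_characteristic_def by (rule conjunct2)
  from this[THEN spec, THEN mp, OF n, THEN spec, of "\<lambda>i. f (g i)"]
  have le: "nrm (\<lambda>\<omega>. MAX u\<in>A. \<bar>f u \<omega>\<bar>) \<le> \<mu> (card A) * (MAX u\<in>A. nrm (f u))"
    unfolding im_comp[of "\<lambda>u. \<bar>f u \<omega>\<bar>" for \<omega>] im_comp[of "\<lambda>u. nrm (f u)"]
    by (rule mp) (intro ballI f gA)
  obtain u where u: "u \<in> A"
    using A(2) by (elim ex_in_conv[THEN iffD2, THEN exE])
  have "nrm (f u) \<le> (MAX u\<in>A. nrm (f u))"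
    using A(1) u by (intro Max_ge) auto
  with nrm_nonneg[OF f[OF u]] have m0: "0 \<le> (MAX u\<in>A. nrm (f u))"
    by simp
  have m1: "(MAX u\<in>A. nrm (f u)) \<le> r"
    using A r by (simp add: Max_le_iff)
  show ?thesis
  proof (cases "0 \<le> \<mu> (card A)")
    case True
    then have "nrm (\<lambda>\<omega>. MAX u\<in>A. \<bar>f u \<omega>\<bar>) \<le> \<mu> (card A) * r"
      using order_trans[OF le mult_left_mono[OF m1]] by simp
    then show ?thesis
      using True m0 m1 by (simp flip: ennreal_mult add: ennreal_leI)
  next
    case False
    then have "nrm (\<lambda>\<omega>. MAX u\<in>A. \<bar>f u \<omega>\<bar>) \<le> 0"
      using order_trans[OF le mult_nonpos_nonneg[OF _ m0]] by simp
    then show ?thesis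
      by (simp add: ennreal_neg)
  qed
qed

end


section \<open>Chaining and oscillations\<close>

context quasi_K_sigma
begin

text \<open>Chaining.  A point of \<open>C (n + m)\<close> is linked to one of \<open>C m\<close> by passing through a nearby point of
  each intermediate net, and the link at level \<open>l\<close> costs at most \<open>\<Delta> l\<close>, the maximum of finitely
  many increments.  The remainder \<open>R m\<close> dominates the sum of all \<open>\<Delta> l\<close> with \<open>l \<ge> m\<close>.  A point \<open>t\<close>
  of \<open>B\<close> is a quasinorm limit of points \<open>t\<^sub>n\<close> of the nets; as \<open>C m\<close> is finite, infinitely many of the
  chains from \<open>t\<^sub>n\<close> end in the same \<open>v\<close>, and this \<open>v\<close> serves for \<open>t\<close>.\<close>

lemma chaining_remainders:
  fixes a :: "nat \<Rightarrow> ennreal"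
  assumes X: "\<And>t. t \<in> B \<Longrightarrow> X t \<in> K"
    and C: "\<And>l. finite (C l)" "\<And>l. C l \<noteq> {}" "\<And>l. C l \<subseteq> B"
    and near: "\<And>l t. t \<in> B \<Longrightarrow> \<exists>u\<in>C l. nrm (\<lambda>\<omega>. X t \<omega> - X u \<omega>) \<le> s l"
    and s: "s \<longlonglongrightarrow> 0"
    and link: "\<And>l p. (\<And>u. u \<in> C (Suc l) \<Longrightarrow> p u \<in> C l \<and> nrm (\<lambda>\<omega>. X u \<omega> - X (p u) \<omega>) \<le> s l) \<Longrightarrow>
      ennreal (nrm (\<lambda>\<omega>. MAX u\<in>C (Suc l). \<bar>X u \<omega> - X (p u) \<omega>\<bar>)) \<le> a l"
    and fin: "(\<Sum>l. a l) < \<infinity>"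
  shows "\<exists>R. \<forall>m. R m \<in> K \<and> ennreal (nrm (R m)) \<le> (\<Sum>l. a (l + m)) \<and>
    (\<forall>t\<in>B. \<exists>v\<in>C m. AE \<omega> in M. \<bar>X t \<omega> - X v \<omega>\<bar> \<le> R m \<omega>)"
proof -
  have "\<forall>l. \<forall>t\<in>B. \<exists>u. u \<in> C l \<and> nrm (\<lambda>\<omega>. X t \<omega> - X u \<omega>) \<le> s l"
    using near by blast
  then have "\<forall>l. \<exists>p. \<forall>t\<in>B. p t \<in> C l \<and> nrm (\<lambda>\<omega>. X t \<omega> - X (p t) \<omega>) \<le> s l"
    by (intro allI bchoice) simp
  then obtain p where "\<forall>l. \<forall>t\<in>B. p l t \<in> C l \<and> nrm (\<lambda>\<omega>. X t \<omega> - X (p l t) \<omega>) \<le> s l"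
    by (elim choice[THEN exE])
  then have p: "p l t \<in> C l" "nrm (\<lambda>\<omega>. X t \<omega> - X (p l t) \<omega>) \<le> s l" if "t \<in> B" for l t
    using that by simp_all
  have CB: "u \<in> B" if "u \<in> C l" for u l
    using C(3) that by blast
  define \<Delta> where "\<Delta> l = (\<lambda>\<omega>. MAX u\<in>C (Suc l). \<bar>X u \<omega> - X (p l u) \<omega>\<bar>)" for l
  have \<Delta>: "\<Delta> l \<in> K" for l
    unfolding \<Delta>_def using C by (intro K_Max K_abs K_diff X CB[of _ "Suc l"] CB[OF p(1)[OF CB[of _ "Suc l"]]]) simp_all
  have le_\<Delta>: "\<bar>X u \<omega> - X (p l u) \<omega>\<bar> \<le> \<Delta> l \<omega>" if "u \<in> C (Suc l)" for u l \<omega>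
    unfolding \<Delta>_def using C that by (intro Max_ge) simp_all
  have \<Delta>0: "0 \<le> \<Delta> l \<omega>" for l \<omega>
    using le_\<Delta>[of _ l \<omega>] C(2)[of "Suc l"] by (metis abs_ge_zero all_not_in_conv order_trans)
  have \<Delta>a: "ennreal (nrm (\<Delta> l)) \<le> a l" for l
    unfolding \<Delta>_def using p CB by (intro link) simp
  have "\<exists>r\<in>K. ennreal (nrm r) \<le> (\<Sum>l. a (l + m)) \<and> (AE \<omega> in M. \<forall>n. (\<Sum>i<n. \<Delta> (i + m) \<omega>) \<le> r \<omega>)" for m
  proof -
    have le: "(\<Sum>l. ennreal (nrm (\<Delta> (l + m)))) \<le> (\<Sum>l. a (l + m))"
      by (intro suminf_le \<Delta>a summableI)
    also have "(\<Sum>l. a (l + m)) \<le> (\<Sum>l. a l)"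
      using suminf_offset[OF summableI, of a m] by simp
    also note fin
    finally have "\<exists>r\<in>K. ennreal (nrm r) \<le> (\<Sum>l. ennreal (nrm (\<Delta> (l + m)))) \<and>
        (AE \<omega> in M. \<forall>n. (\<Sum>i<n. \<Delta> (i + m) \<omega>) \<le> r \<omega>)"
      by (intro series_dominated[of "\<lambda>l. \<Delta> (l + m)"] \<Delta> \<Delta>0)
    then show ?thesis
      using order_trans[OF _ le] by blast
  qed
  then have "\<forall>m. \<exists>r. r \<in> K \<and> ennreal (nrm r) \<le> (\<Sum>l. a (l + m)) \<and>
      (AE \<omega> in M. \<forall>n. (\<Sum>i<n. \<Delta> (i + m) \<omega>) \<le> r \<omega>)"
    by blast
  then obtain R where R': "\<forall>m. R m \<in> K \<and> ennreal (nrm (R m)) \<le> (\<Sum>l. a (l + m)) \<and>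
      (AE \<omega> in M. \<forall>n. (\<Sum>i<n. \<Delta> (i + m) \<omega>) \<le> R m \<omega>)"
    by (elim choice[THEN exE])
  then have R: "R m \<in> K" "ennreal (nrm (R m)) \<le> (\<Sum>l. a (l + m))"
    "AE \<omega> in M. \<forall>n. (\<Sum>i<n. \<Delta> (i + m) \<omega>) \<le> R m \<omega>" for m
    by simp_all
  have chain: "\<forall>u\<in>C (n + m). \<exists>v\<in>C m. \<forall>\<omega>. \<bar>X u \<omega> - X v \<omega>\<bar> \<le> (\<Sum>i<n. \<Delta> (i + m) \<omega>)" for n m
  proof (induction n)
    case 0
    show ?case by auto
  next
    case (Suc n)
    show ?case
    proof
      fix u assume u: "u \<in> C (Suc n + m)"
      obtain v where v: "v \<in> C m" "\<And>\<omega>. \<bar>X (p (n + m) u) \<omega> - X v \<omega>\<bar> \<le> (\<Sum>i<n. \<Delta> (i + m) \<omega>)"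
        using Suc.IH p(1)[OF CB[OF u], of "n + m"] by blast
      have "\<bar>X u \<omega> - X v \<omega>\<bar> \<le> (\<Sum>i<Suc n. \<Delta> (i + m) \<omega>)" for \<omega>
        using le_\<Delta>[of u "n + m" \<omega>] u v(2)[of \<omega>] by simp
      with v(1) show "\<exists>v\<in>C m. \<forall>\<omega>. \<bar>X u \<omega> - X v \<omega>\<bar> \<le> (\<Sum>i<Suc n. \<Delta> (i + m) \<omega>)"
        by blast
    qed
  qed
  have "\<exists>v\<in>C m. AE \<omega> in M. \<bar>X t \<omega> - X v \<omega>\<bar> \<le> R m \<omega>" if t: "t \<in> B" for t m
  proof -
    have "\<forall>n. \<exists>v. v \<in> C m \<and> (\<forall>\<omega>. \<bar>X (p (n + m) t) \<omega> - X v \<omega>\<bar> \<le> (\<Sum>i<n. \<Delta> (i + m) \<omega>))"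
      using chain p(1)[OF t] by blast
    then obtain w where "\<forall>n. w n \<in> C m \<and> (\<forall>\<omega>. \<bar>X (p (n + m) t) \<omega> - X (w n) \<omega>\<bar> \<le> (\<Sum>i<n. \<Delta> (i + m) \<omega>))"
      by (elim choice[THEN exE])
    then have w: "w n \<in> C m" "\<bar>X (p (n + m) t) \<omega> - X (w n) \<omega>\<bar> \<le> (\<Sum>i<n. \<Delta> (i + m) \<omega>)" for n \<omega>
      by simp_all
    have "finite (range w)"
      using w(1) C(1) by (intro finite_subset[of "range w" "C m"]) auto
    then obtain n0 where inf: "infinite {n. w n = w n0}"
      using pigeonhole_infinite[of UNIV w] by auto
    let ?v = "w n0"
    have "AE \<omega> in M. \<bar>X t \<omega> - X ?v \<omega>\<bar> \<le> R m \<omega>"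
    proof (rule AE_le_of_small_excess)
      fix e :: real assume "e > 0"
      then have "eventually (\<lambda>n. s (n + m) < e) sequentially"
        by (intro order_tendstoD[OF LIMSEQ_ignore_initial_segment[OF s]])
      then obtain N where "\<And>n. n \<ge> N \<Longrightarrow> s (n + m) < e"
        unfolding eventually_sequentially by blast
      moreover obtain n where "n \<ge> N" "w n = ?v"
        using inf unfolding infinite_nat_iff_unbounded_le by blast
      ultimately have n: "s (n + m) < e" "w n = ?v"
        by simp_all
      let ?h = "\<lambda>\<omega>. \<bar>X t \<omega> - X (p (n + m) t) \<omega>\<bar>"
      have D: "(\<lambda>\<omega>. X t \<omega> - X (p (n + m) t) \<omega>) \<in> K"
        by (intro K_diff X t CB[OF p(1)[OF t]])
      have "nrm ?h < e"
        using nrm_abs[OF D] p(2)[OF t, of "n + m"] n(1) by simp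
      moreover have "AE \<omega> in M. \<bar>X t \<omega> - X ?v \<omega>\<bar> \<le> R m \<omega> + ?h \<omega>"
        using R(3)[of m]
      proof eventually_elim
        case (elim \<omega>)
        then show ?case
          using w(2)[of n \<omega>] spec[OF elim, of n] unfolding n(2) by linarith
      qed
      ultimately show "\<exists>h\<in>K. nrm h < e \<and> (AE \<omega> in M. \<bar>X t \<omega> - X ?v \<omega>\<bar> \<le> R m \<omega> + h \<omega>)"
        using K_abs[OF D] by (intro bexI[of _ ?h] conjI)
    qed (rule R(1) K_abs K_diff X t CB[OF w(1)])+
    then show ?thesis
      using w(1) by blast
  qed
  with R(1,2) show ?thesis
    by blast
qed

text \<open>All increments over small distances are dominated by one random variable of small quasinorm.
  Two close points \<open>s\<close>, \<open>t\<close> are at a cost of \<open>R\<close> each from points \<open>x = q s\<close>, \<open>y = q t\<close> of a finite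
  net, but \<open>x\<close> and \<open>y\<close> need not be close to each other.  For every pair \<open>(x, y)\<close> that arises in this
  way, one fixes a close pair \<open>(u, v)\<close> giving rise to it and goes from \<open>s\<close> to \<open>t\<close> along
  \<open>s, x, u, v, y, t\<close>.  This costs four times \<open>R\<close> and the increment \<open>X u - X v\<close>, and only finitely
  many such increments occur, whatever \<open>s\<close> and \<open>t\<close> are.\<close>

lemma oscillation_dominated:
  assumes X: "\<And>t. t \<in> B \<Longrightarrow> X t \<in> K"
    and net: "\<And>e. e > 0 \<Longrightarrow> \<exists>R\<in>K. nrm R < e \<and> (\<exists>C. finite C \<and> C \<subseteq> B \<and>
      (\<forall>t\<in>B. \<exists>v\<in>C. AE \<omega> in M. \<bar>X t \<omega> - X v \<omega>\<bar> \<le> R \<omega>))"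
    and cont: "\<And>e. e > 0 \<Longrightarrow> \<exists>h>0. \<forall>s\<in>B. \<forall>t\<in>B. \<rho> s t < h \<longrightarrow> nrm (\<lambda>\<omega>. X s \<omega> - X t \<omega>) < e"
    and e: "e > 0"
  shows "\<exists>V\<in>K. nrm V < e \<and> (\<forall>\<omega>. 0 \<le> V \<omega>) \<and>
    (\<exists>h>0. \<forall>s\<in>B. \<forall>t\<in>B. \<rho> s t < h \<longrightarrow> (AE \<omega> in M. \<bar>X s \<omega> - X t \<omega>\<bar> \<le> V \<omega>))"
proof -
  obtain R C where R: "R \<in> K" "nrm R < e / 8" and C: "finite C" "C \<subseteq> B"
    and net': "\<forall>t\<in>B. \<exists>v\<in>C. AE \<omega> in M. \<bar>X t \<omega> - X v \<omega>\<bar> \<le> R \<omega>"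
    using net[of "e / 8"] e by auto
  obtain q where q: "\<And>t. t \<in> B \<Longrightarrow> q t \<in> C" "\<And>t. t \<in> B \<Longrightarrow> AE \<omega> in M. \<bar>X t \<omega> - X (q t) \<omega>\<bar> \<le> R \<omega>"
    using net' by metis
  \<comment> \<open>An upper bound for the number of pairs; the summand 1 keeps it positive.\<close>
  define N where "N = real (card (C \<times> C)) + 1"
  have N: "N > 0"
    unfolding N_def by simp
  obtain h where h: "h > 0" "\<And>s t. s \<in> B \<Longrightarrow> t \<in> B \<Longrightarrow> \<rho> s t < h \<Longrightarrow> nrm (\<lambda>\<omega>. X s \<omega> - X t \<omega>) < e / (2 * N)"
    using cont[of "e / (2 * N)"] e N by auto
  define P where "P = {(s, t). s \<in> B \<and> t \<in> B \<and> \<rho> s t < h}"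
  define Z where "Z = map_prod q q ` P"
  define g where "g = inv_into P (map_prod q q)"
  have Z: "Z \<subseteq> C \<times> C"
    using q(1) unfolding Z_def P_def by auto
  have finZ: "finite Z"
    by (rule finite_subset[OF Z]) (simp add: C)
  have g: "fst (g z) \<in> B" "snd (g z) \<in> B" "\<rho> (fst (g z)) (snd (g z)) < h"
    "q (fst (g z)) = fst z" "q (snd (g z)) = snd z" if "z \<in> Z" for z
    using inv_into_into[of z "map_prod q q" P] f_inv_into_f[of z "map_prod q q" P] that
    unfolding Z_def[symmetric] g_def[symmetric] by (auto simp: P_def map_prod_def split: prod.splits)
  define W where "W = (\<lambda>\<omega>. \<Sum>z\<in>Z. \<bar>X (fst (g z)) \<omega> - X (snd (g z)) \<omega>\<bar>)"
  have D: "(\<lambda>\<omega>. X (fst (g z)) \<omega> - X (snd (g z)) \<omega>) \<in> K" if "z \<in> Z" for z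
    using g that by (intro K_diff X)
  have W: "W \<in> K"
    unfolding W_def by (intro K_sum K_abs D)
  have "nrm W \<le> (\<Sum>z\<in>Z. nrm (\<lambda>\<omega>. \<bar>X (fst (g z)) \<omega> - X (snd (g z)) \<omega>\<bar>))"
    unfolding W_def by (intro nrm_sum K_abs D)
  also have "\<dots> \<le> (\<Sum>z\<in>Z. e / (2 * N))"
    using h(2) g by (intro sum_mono) (simp add: nrm_abs[OF D] less_imp_le)
  also have "\<dots> = real (card Z) * (e / (2 * N))"
    by simp
  also have "\<dots> \<le> real (card (C \<times> C)) * (e / (2 * N))"
    using C e N by (intro mult_right_mono of_nat_mono card_mono Z) simp_all
  also have "\<dots> < N * (e / (2 * N))"
    using e N by (intro mult_strict_right_mono) (simp_all add: N_def)
  also have "\<dots> = e / 2"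
    using N by simp
  finally have nW: "nrm W < e / 2" .
  \<comment> \<open>Four copies of \<open>R\<close> are written as a sum because the quasinorm is subadditive but need not be
    homogeneous.\<close>
  define V where "V = (\<lambda>\<omega>. (\<Sum>i<4::nat. \<bar>R \<omega>\<bar>) + W \<omega>)"
  have S: "(\<lambda>\<omega>. \<Sum>i<4::nat. \<bar>R \<omega>\<bar>) \<in> K"
    by (intro K_sum K_abs R)
  have V: "V \<in> K"
    unfolding V_def by (intro K_add S W)
  have "nrm V \<le> nrm (\<lambda>\<omega>. \<Sum>i<4::nat. \<bar>R \<omega>\<bar>) + nrm W"
    unfolding V_def by (intro nrm_triangle S W)
  also have "nrm (\<lambda>\<omega>. \<Sum>i<4::nat. \<bar>R \<omega>\<bar>) \<le> (\<Sum>i<4::nat. nrm (\<lambda>\<omega>. \<bar>R \<omega>\<bar>))"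
    by (intro nrm_sum K_abs R)
  also have "\<dots> = 4 * nrm R"
    by (simp add: nrm_abs R)
  finally have nV: "nrm V < e"
    using R(2) nW by simp
  have W0: "0 \<le> W \<omega>" for \<omega>
    unfolding W_def by (intro sum_nonneg) simp
  have V0: "\<forall>\<omega>. 0 \<le> V \<omega>"
    using W0 by (simp add: V_def)
  have "AE \<omega> in M. \<bar>X s \<omega> - X t \<omega>\<bar> \<le> V \<omega>" if st: "s \<in> B" "t \<in> B" "\<rho> s t < h" for s t
  proof -
    let ?z = "(q s, q t)"
    have z: "?z \<in> Z"
      using st unfolding Z_def P_def by (intro image_eqI[of _ _ "(s, t)"]) auto
    let ?u = "fst (g ?z)" and ?v = "snd (g ?z)"
    have eq: "q ?u = q s" "q ?v = q t"
      using g(4,5)[OF z] by simp_all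
    have WW: "\<bar>X ?u \<omega> - X ?v \<omega>\<bar> \<le> W \<omega>" for \<omega>
      unfolding W_def using member_le_sum[OF z, of "\<lambda>z. \<bar>X (fst (g z)) \<omega> - X (snd (g z)) \<omega>\<bar>"] finZ by simp
    show ?thesis
      using q(2)[OF st(1)] q(2)[OF st(2)] q(2)[OF g(1)[OF z], unfolded eq] q(2)[OF g(2)[OF z], unfolded eq]
    proof eventually_elim
      case (elim \<omega>)
      then show ?case
        using WW[of \<omega>] by (simp add: V_def)
    qed
  qed
  with h(1) V nV V0 show ?thesis
    by blast
qed

end

text \<open>An almost sure modulus of continuity.  The exceptional null set may depend on the pair of
  points, so that on a countable set of points \<open>X\<close> has uniformly continuous paths almost surely;
  separability extends this to uncountable sets.\<close>

definition as_modulus_on :: "'w measure \<Rightarrow> 't set \<Rightarrow> ('t \<Rightarrow> 't \<Rightarrow> real) \<Rightarrow> ('t \<Rightarrow> 'w \<Rightarrow> real) \<Rightarrow> bool" where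
  "as_modulus_on M B \<rho> X \<longleftrightarrow>
     (\<exists>V h. (\<forall>i::nat. 0 < h i) \<and> (AE \<omega> in M. (\<lambda>i. V i \<omega> :: real) \<longlonglongrightarrow> 0) \<and>
        (\<forall>i. \<forall>s\<in>B. \<forall>t\<in>B. \<rho> s t < h i \<longrightarrow> (AE \<omega> in M. \<bar>X s \<omega> - X t \<omega>\<bar> \<le> V i \<omega>)))"

text \<open>Dominating variables \<open>V i\<close> of quasinorm below \<open>2\<^bsup>-i\<^esup>\<close> have an almost surely finite sum by
  \<open>series_dominated\<close>, and therefore tend to zero almost surely.\<close>

lemma (in quasi_K_sigma) as_modulus_onI:
  assumes osc: "\<And>e. e > 0 \<Longrightarrow> \<exists>V\<in>K. nrm V < e \<and> (\<forall>\<omega>. 0 \<le> V \<omega>) \<and>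
    (\<exists>h>0. \<forall>s\<in>B. \<forall>t\<in>B. \<rho> s t < h \<longrightarrow> (AE \<omega> in M. \<bar>X s \<omega> - X t \<omega>\<bar> \<le> V \<omega>))"
  shows "as_modulus_on M B \<rho> X"
proof -
  have "\<exists>V h. V \<in> K \<and> nrm V < (1 / 2) ^ i \<and> (\<forall>\<omega>. 0 \<le> V \<omega>) \<and>
    h > 0 \<and> (\<forall>s\<in>B. \<forall>t\<in>B. \<rho> s t < h \<longrightarrow> (AE \<omega> in M. \<bar>X s \<omega> - X t \<omega>\<bar> \<le> V \<omega>))" for i :: nat
    using osc[of "(1 / 2) ^ i"] by auto
  then have "\<forall>i :: nat. \<exists>V h. V \<in> K \<and> nrm V < (1 / 2) ^ i \<and> (\<forall>\<omega>. 0 \<le> V \<omega>) \<and>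
    h > 0 \<and> (\<forall>s\<in>B. \<forall>t\<in>B. \<rho> s t < h \<longrightarrow> (AE \<omega> in M. \<bar>X s \<omega> - X t \<omega>\<bar> \<le> V \<omega>))"
    by (rule allI)
  then obtain V h where Vh: "\<forall>i :: nat. V i \<in> K \<and> nrm (V i) < (1 / 2) ^ i \<and> (\<forall>\<omega>. 0 \<le> V i \<omega>) \<and>
    h i > 0 \<and> (\<forall>s\<in>B. \<forall>t\<in>B. \<rho> s t < h i \<longrightarrow> (AE \<omega> in M. \<bar>X s \<omega> - X t \<omega>\<bar> \<le> V i \<omega>))"
    by (elim choice[THEN exE])
  then have V: "V i \<in> K" "nrm (V i) < (1 / 2) ^ i" "0 \<le> V i \<omega>" for i \<omega>
    by simp_all
  have "(\<Sum>i. ennreal (nrm (V i))) \<le> (\<Sum>i. ennreal ((1 / 2) ^ i))"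
    using V(2) by (intro suminf_le summableI ennreal_leI less_imp_le)
  also have "\<dots> = ennreal (\<Sum>i. (1 / 2) ^ i)"
    by (intro suminf_ennreal2 summable_geometric) simp_all
  also have "\<dots> < \<infinity>"
    by simp
  finally obtain \<eta> where "AE \<omega> in M. \<forall>n. (\<Sum>i<n. V i \<omega>) \<le> \<eta> \<omega>"
    using series_dominated[of V] V(1,3) by blast
  then have "AE \<omega> in M. (\<lambda>i. V i \<omega>) \<longlonglongrightarrow> 0"
  proof eventually_elim
    case (elim \<omega>)
    then have "summable (\<lambda>i. V i \<omega>)"
      using V(3) by (intro summableI_nonneg_bounded[of _ "\<eta> \<omega>"]) auto
    then show ?case
      by (rule summable_LIMSEQ_zero)
  qed
  with Vh show ?thesis
    unfolding as_modulus_on_def by (intro exI[of _ V] exI[of _ h]) simp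
qed


section \<open>Compact sets and weighted processes\<close>

lemma openin_ball:
  assumes \<rho>: "pseudometric_on T \<rho>" and x: "x \<in> T"
  shows "openin (pm_topology T \<rho>) {y\<in>T. \<rho> x y < r}"
  unfolding openin_pm_topology
proof (intro conjI ballI)
  fix y assume "y \<in> {y\<in>T. \<rho> x y < r}"
  then have y: "y \<in> T" "\<rho> x y < r"
    by simp_all
  have "\<rho> x z < r" if "z \<in> T" "\<rho> y z < r - \<rho> x y" for z
    using \<rho> x y that unfolding pseudometric_on_def by (smt (verit))
  then show "\<exists>d>0. \<forall>z\<in>T. \<rho> y z < d \<longrightarrow> z \<in> {y\<in>T. \<rho> x y < r}"
    using y by (intro exI[of _ "r - \<rho> x y"]) simp
qed simp

lemma compactin_finite_net:
  assumes \<rho>: "pseudometric_on T \<rho>" and B: "compactin (pm_topology T \<rho>) B" and r: "r > 0"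
  shows "\<exists>C. finite C \<and> C \<subseteq> B \<and> B \<subseteq> (\<Union>x\<in>C. {y. \<rho> x y < r})"
proof -
  have BT: "B \<subseteq> T"
    using compactin_subset_topspace[OF B] by simp
  have "\<exists>\<F>. finite \<F> \<and> \<F> \<subseteq> (\<lambda>x. {y\<in>T. \<rho> x y < r}) ` B \<and> B \<subseteq> \<Union>\<F>"
  proof (rule compactinD[OF B])
    show "\<And>U. U \<in> (\<lambda>x. {y\<in>T. \<rho> x y < r}) ` B \<Longrightarrow> openin (pm_topology T \<rho>) U"
      using BT openin_ball[OF \<rho>] by auto
    have "\<rho> x x < r" if "x \<in> B" for x
      using \<rho> BT that r unfolding pseudometric_on_def by auto
    then show "B \<subseteq> \<Union>((\<lambda>x. {y\<in>T. \<rho> x y < r}) ` B)"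
      using BT by blast
  qed
  then obtain \<F> where \<F>: "finite \<F>" "\<F> \<subseteq> (\<lambda>x. {y\<in>T. \<rho> x y < r}) ` B" and cover: "B \<subseteq> \<Union>\<F>"
    by (elim exE conjE)
  obtain C where "finite C" "C \<subseteq> B" and C: "\<F> = (\<lambda>x. {y\<in>T. \<rho> x y < r}) ` C"
    using finite_subset_image[OF \<F>] by (elim exE conjE)
  moreover have "B \<subseteq> (\<Union>x\<in>C. {y. \<rho> x y < r})"
    using cover unfolding C by blast
  ultimately show ?thesis
    by blast
qed

lemma covering_number_attained:
  assumes "covering_number \<rho> B r \<noteq> \<infinity>"
  obtains C where "finite C" "C \<subseteq> B" "B \<subseteq> (\<Union>x\<in>C. {y. \<rho> x y < r})"
    "covering_number \<rho> B r = enat (card C)"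
proof -
  let ?N = "{enat (card C) | C. finite C \<and> C \<subseteq> B \<and> B \<subseteq> (\<Union>x\<in>C. {y. \<rho> x y < r})}"
  have "?N \<noteq> {}"
    using assms unfolding covering_number_def by (metis (no_types, lifting) Inf_enat_def)
  then have "covering_number \<rho> B r \<in> ?N"
    unfolding covering_number_def by (metis (no_types, lifting) ex_in_conv wellorder_InfI)
  then show ?thesis
    using that by blast
qed

lemma covering_number_finite:
  assumes "pseudometric_on T \<rho>" "compactin (pm_topology T \<rho>) B" "r > 0"
  shows "covering_number \<rho> B r \<noteq> \<infinity>"
proof -
  obtain C where "finite C \<and> C \<subseteq> B \<and> B \<subseteq> (\<Union>x\<in>C. {y. \<rho> x y < r})"
    using compactin_finite_net[OF assms] by blast
  then have "covering_number \<rho> B r \<le> enat (card C)"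
    unfolding covering_number_def by (intro Inf_lower) blast
  then show ?thesis
    using enat_ile by fastforce
qed

text \<open>This is separability of the graph of \<open>c\<close>, a subset of the product of \<open>B\<close> with the real line.
  From each set of points near a net point with weight near a rational number, a single point is
  picked.  A set that is dense for \<open>\<rho>\<close>
  alone may miss all large values of a discontinuous \<open>c\<close>.\<close>

lemma countable_weight_dense:
  fixes c :: "'t \<Rightarrow> real"
  assumes \<rho>: "pseudometric_on T \<rho>" and B: "compactin (pm_topology T \<rho>) B"
  shows "\<exists>D. countable D \<and> D \<subseteq> B \<and> (\<forall>t\<in>B. \<forall>e>0. \<exists>d\<in>D. \<rho> d t < e \<and> \<bar>c d - c t\<bar> < e)"
proof -
  have BT: "B \<subseteq> T"
    using compactin_subset_topspace[OF B] by simp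
  have "\<forall>n. \<exists>C. finite C \<and> C \<subseteq> B \<and> B \<subseteq> (\<Union>x\<in>C. {y. \<rho> x y < 1 / real (Suc n)})"
    using compactin_finite_net[OF \<rho> B] by simp
  then obtain C where C: "\<And>n. finite (C n)" "\<And>n. C n \<subseteq> B"
    "\<And>n. B \<subseteq> (\<Union>x\<in>C n. {y. \<rho> x y < 1 / real (Suc n)})"
    by metis
  let ?near = "\<lambda>(n::nat) x q t. t \<in> B \<and> \<rho> x t < 1 / real (Suc n) \<and> \<bar>c t - of_rat q\<bar> < 1 / real (Suc n)"
  define pick where "pick = (\<lambda>(n, x, q). SOME t. ?near n x q t)"
  define I where "I = {(n, x, q) \<in> UNIV \<times> (\<Union>n. C n) \<times> UNIV. \<exists>t. ?near n x q t}"
  have pick: "?near n x q (pick (n, x, q))" if "?near n x q t" for n x q t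
    unfolding pick_def using someI[of "?near n x q", OF that] by simp
  have "countable (UNIV \<times> (\<Union>n. C n) \<times> (UNIV :: rat set) :: (nat \<times> _) set)"
    using C(1) by (intro countable_SIGMA countable_UN countableI_type) (auto intro: countable_finite)
  then have "countable (pick ` I)"
    unfolding I_def by (intro countable_image) (rule countable_subset[rotated], auto)
  moreover have "pick ` I \<subseteq> B"
    using pick unfolding I_def by fast
  moreover have "\<exists>d\<in>pick ` I. \<rho> d t < e \<and> \<bar>c d - c t\<bar> < e" if t: "t \<in> B" and e: "e > 0" for t and e :: real
  proof -
    obtain n where n: "1 / real (Suc n) < e / 2"
      using nat_approx_posE[of "e / 2"] e by auto
    obtain x where x: "x \<in> C n" "\<rho> x t < 1 / real (Suc n)"
      using C(3)[of n] t by blast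
    obtain q where "c t - 1 / real (Suc n) < of_rat q" "of_rat q < c t + 1 / real (Suc n)"
      using of_rat_dense[of "c t - 1 / real (Suc n)" "c t + 1 / real (Suc n)"] by auto
    then have q: "\<bar>c t - of_rat q\<bar> < 1 / real (Suc n)"
      by linarith
    let ?d = "pick (n, x, q)"
    have d: "?d \<in> B" "\<rho> x ?d < 1 / real (Suc n)" "\<bar>c ?d - of_rat q\<bar> < 1 / real (Suc n)"
      using pick[where t = t and n = n and x = x and q = q] t x(2) q by blast+
    have "(n, x, q) \<in> I"
      using t x q unfolding I_def by blast
    moreover have "\<rho> ?d t \<le> \<rho> ?d x + \<rho> x t" "\<rho> ?d x = \<rho> x ?d"
      using \<rho> BT C(2)[of n] x(1) d(1) t unfolding pseudometric_on_def by (meson subsetD)+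
    ultimately show ?thesis
      using n d(2,3) x(2) q by (intro bexI[of _ ?d] conjI) auto
  qed
  ultimately show ?thesis
    by (intro exI[of _ "pick ` I"] conjI ballI allI impI) simp_all
qed

text \<open>The path-by-path argument: the value at \<open>t\<close> is a limit of the values at points of \<open>D\<close> along which
  both the weight and the path converge.\<close>

lemma weighted_limit_bound:
  fixes c x :: "'t \<Rightarrow> real" and V h :: "nat \<Rightarrow> real"
  assumes V: "V \<longlonglongrightarrow> 0" and h: "\<And>i. 0 < h i"
    and dense: "\<And>e. e > 0 \<Longrightarrow> \<exists>d\<in>D. \<rho> d t < e \<and> \<bar>c d - c t\<bar> < e"
    and near: "\<And>i d. d \<in> D \<Longrightarrow> \<rho> d t < h i \<Longrightarrow> \<bar>x d - x t\<bar> \<le> V i"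
    and le: "\<And>d. d \<in> D \<Longrightarrow> \<bar>c d * x d\<bar> \<le> b" and c: "\<bar>c t\<bar> \<le> 1"
  shows "\<bar>c t * x t\<bar> \<le> b"
proof -
  \<comment> \<open>A second small quantity besides \<open>h i\<close>, which is only known to be positive.\<close>
  let ?e = "\<lambda>i. 1 / real (Suc i)"
  have "\<bar>c t * x t\<bar> \<le> b + ?e i * (\<bar>x t\<bar> + V i) + V i" for i
  proof -
    obtain d where d: "d \<in> D" "\<rho> d t < min (h i) (?e i)" "\<bar>c d - c t\<bar> < min (h i) (?e i)"
      using dense[of "min (h i) (?e i)"] h[of i] by auto
    have V: "\<bar>x d - x t\<bar> \<le> V i"
      using near[OF d(1)] d(2) by simp
    have "c t * x t = c d * x d + (c t - c d) * x d + c t * (x t - x d)"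
      by (simp add: algebra_simps)
    then have "\<bar>c t * x t\<bar> \<le> \<bar>c d * x d\<bar> + \<bar>c t - c d\<bar> * \<bar>x d\<bar> + \<bar>c t\<bar> * \<bar>x t - x d\<bar>"
      by (simp flip: abs_mult)
    also have "\<dots> \<le> b + ?e i * (\<bar>x t\<bar> + V i) + 1 * V i"
      using d(3) V c by (intro add_mono mult_mono le d(1)) auto
    finally show ?thesis
      by simp
  qed
  moreover have "(\<lambda>i. b + ?e i * (\<bar>x t\<bar> + V i) + V i) \<longlonglongrightarrow> b + 0 * (\<bar>x t\<bar> + 0) + 0"
    by (intro tendsto_intros V LIMSEQ_Suc[OF lim_1_over_n])
  ultimately have "\<bar>c t * x t\<bar> \<le> b + 0 * (\<bar>x t\<bar> + 0) + 0"
    by (intro LIMSEQ_le_const) auto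
  then show ?thesis
    by simp
qed

lemma AE_weighted_le:
  assumes D: "countable D" "D \<subseteq> B"
    and dense: "\<And>e. e > 0 \<Longrightarrow> \<exists>d\<in>D. \<rho> d t < e \<and> \<bar>c d - c t\<bar> < e"
    and modulus: "as_modulus_on M B \<rho> X" and t: "t \<in> B" and c: "\<bar>c t\<bar> \<le> 1"
    and le: "AE \<omega> in M. \<forall>d\<in>D. \<bar>c d * X d \<omega>\<bar> \<le> \<xi> \<omega>"
  shows "AE \<omega> in M. \<bar>c t * X t \<omega>\<bar> \<le> \<xi> \<omega>"
proof -
  obtain V h where h: "\<forall>i::nat. 0 < h i" and V: "AE \<omega> in M. (\<lambda>i. V i \<omega>) \<longlonglongrightarrow> 0"
    and mod: "\<forall>i. \<forall>s\<in>B. \<forall>t\<in>B. \<rho> s t < h i \<longrightarrow> (AE \<omega> in M. \<bar>X s \<omega> - X t \<omega>\<bar> \<le> V i \<omega>)"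
    using modulus unfolding as_modulus_on_def by (elim exE conjE)
  have "AE \<omega> in M. \<rho> d t < h i \<longrightarrow> \<bar>X d \<omega> - X t \<omega>\<bar> \<le> V i \<omega>" if "d \<in> D" for i d
  proof -
    have "d \<in> B"
      using D(2) that by (simp add: subset_iff)
    then show ?thesis
      using mod t by (cases "\<rho> d t < h i") simp_all
  qed
  then have "AE \<omega> in M. \<forall>d\<in>D. \<forall>i. \<rho> d t < h i \<longrightarrow> \<bar>X d \<omega> - X t \<omega>\<bar> \<le> V i \<omega>"
    by (simp add: AE_ball_countable[OF D(1)] AE_all_countable)
  with V le show ?thesis
  proof eventually_elim
    case (elim \<omega>)
    show ?case
      by (rule weighted_limit_bound[of "\<lambda>i. V i \<omega>" h D \<rho> t c "\<lambda>t. X t \<omega>"])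
        (use h dense c elim in auto)
  qed
qed

text \<open>With separability on \<open>B\<close> a single null set serves for all \<open>t\<close>.  Around \<open>d \<in> D\<close> the paths stay
  within \<open>V i\<close> of their value at \<open>d\<close>, first at the points of the countable separating set, and then,
  as the interval of radius \<open>V i\<close> is closed and the ball around \<open>d\<close> open, on the whole ball.  The
  estimate on increments thereby holds for all \<open>t\<close> on the same path.\<close>

lemma AE_weighted_le_pointwise:
  assumes \<rho>: "pseudometric_on B \<rho>" and X: "separable_process M B \<rho> X"
    and D: "countable D" "D \<subseteq> B"
    and dense: "\<And>t e. t \<in> B \<Longrightarrow> e > 0 \<Longrightarrow> \<exists>d\<in>D. \<rho> d t < e \<and> \<bar>c d - c t\<bar> < e"
    and modulus: "as_modulus_on M B \<rho> X" and c: "\<And>t. t \<in> B \<Longrightarrow> \<bar>c t\<bar> \<le> 1"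
    and le: "AE \<omega> in M. \<forall>d\<in>D. \<bar>c d * X d \<omega>\<bar> \<le> \<xi> \<omega>"
  shows "AE \<omega> in M. \<forall>t\<in>B. \<bar>c t * X t \<omega>\<bar> \<le> \<xi> \<omega>"
proof -
  obtain S N where S: "countable S" "S \<subseteq> B" and N: "N \<in> null_sets M"
    and sep: "\<forall>\<omega>\<in>space M - N. \<forall>U F. openin (pm_topology B \<rho>) U \<and> closed F \<and>
       (\<forall>s\<in>S \<inter> U. X s \<omega> \<in> F) \<longrightarrow> (\<forall>t\<in>U. X t \<omega> \<in> F)"
    using X unfolding separable_process_def by (elim exE conjE)
  obtain V h where h: "\<forall>i::nat. 0 < h i" and V: "AE \<omega> in M. (\<lambda>i. V i \<omega>) \<longlonglongrightarrow> 0"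
    and mod: "\<forall>i. \<forall>s\<in>B. \<forall>t\<in>B. \<rho> s t < h i \<longrightarrow> (AE \<omega> in M. \<bar>X s \<omega> - X t \<omega>\<bar> \<le> V i \<omega>)"
    using modulus unfolding as_modulus_on_def by (elim exE conjE)
  have "AE \<omega> in M. \<rho> d s < h i \<longrightarrow> \<bar>X d \<omega> - X s \<omega>\<bar> \<le> V i \<omega>" if "d \<in> D" "s \<in> S" for i d s
  proof -
    have "d \<in> B" "s \<in> B"
      using D(2) S(2) that by (simp_all add: subset_iff)
    then show ?thesis
      using mod by (cases "\<rho> d s < h i") simp_all
  qed
  then have "AE \<omega> in M. \<forall>d\<in>D. \<forall>s\<in>S. \<forall>i. \<rho> d s < h i \<longrightarrow> \<bar>X d \<omega> - X s \<omega>\<bar> \<le> V i \<omega>"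
    by (simp add: AE_ball_countable[OF D(1)] AE_ball_countable[OF S(1)] AE_all_countable)
  with V le AE_space AE_not_in[OF N] show ?thesis
  proof eventually_elim
    case (elim \<omega>)
    have near: "\<bar>X d \<omega> - X t \<omega>\<bar> \<le> V i \<omega>" if d: "d \<in> D" and t: "t \<in> B" "\<rho> d t < h i" for d t i
    proof -
      let ?U = "{y\<in>B. \<rho> d y < h i}" and ?F = "cball (X d \<omega>) (V i \<omega>)"
      have "openin (pm_topology B \<rho>) ?U"
        using D(2) d by (intro openin_ball[OF \<rho>]) auto
      moreover have "\<forall>s\<in>S \<inter> ?U. X s \<omega> \<in> ?F"
        using elim(5) d by (auto simp: dist_real_def)
      ultimately have "\<forall>t\<in>?U. X t \<omega> \<in> ?F"
        using sep[rule_format, of \<omega> ?U ?F] elim(3,4) by simp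
      then show ?thesis
        using t by (simp add: dist_real_def)
    qed
    show ?case
    proof
      fix t assume t: "t \<in> B"
      show "\<bar>c t * X t \<omega>\<bar> \<le> \<xi> \<omega>"
        by (rule weighted_limit_bound[of "\<lambda>i. V i \<omega>" h D \<rho> t c "\<lambda>t. X t \<omega>"])
          (use h dense[OF t] c[OF t] near[OF _ t] elim(1,2) in auto)
    qed
  qed
qed

text \<open>Separability applied to the open set \<open>T\<close> and the closed interval from \<open>- \<xi> \<omega>\<close> to \<open>\<xi> \<omega>\<close>.\<close>

lemma separable_process_AE_le:
  assumes X: "separable_process M T \<rho> X"
    and le: "\<And>t. t \<in> T \<Longrightarrow> AE \<omega> in M. \<bar>X t \<omega>\<bar> \<le> \<xi> \<omega>"
  shows "AE \<omega> in M. \<forall>t\<in>T. \<bar>X t \<omega>\<bar> \<le> \<xi> \<omega>"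
proof -
  obtain S N where S: "countable S" "S \<subseteq> T" and N: "N \<in> null_sets M"
    and sep: "\<forall>\<omega>\<in>space M - N. \<forall>U F. openin (pm_topology T \<rho>) U \<and> closed F \<and>
       (\<forall>s\<in>S \<inter> U. X s \<omega> \<in> F) \<longrightarrow> (\<forall>t\<in>U. X t \<omega> \<in> F)"
    using X unfolding separable_process_def by (elim exE conjE)
  have "AE \<omega> in M. \<forall>s\<in>S. \<bar>X s \<omega>\<bar> \<le> \<xi> \<omega>"
    using le S by (auto simp: AE_ball_countable)
  with AE_space AE_not_in[OF N] show ?thesis
  proof eventually_elim
    case (elim \<omega>)
    have "\<forall>s\<in>S \<inter> T. X s \<omega> \<in> cball 0 (\<xi> \<omega>)"
      using elim(3) by (auto simp: dist_real_def)
    moreover have "openin (pm_topology T \<rho>) T"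
      using openin_topspace[of "pm_topology T \<rho>"] by simp
    ultimately have "\<forall>t\<in>T. X t \<omega> \<in> cball 0 (\<xi> \<omega>)"
      using sep[rule_format, of \<omega> T "cball 0 (\<xi> \<omega>)"] elim(1,2) by simp
    then show ?case
      by (auto simp: dist_real_def)
  qed
qed


section \<open>The chaining estimate on a compact set\<close>

lemma ennreal_suminf_tail_small:
  fixes a :: "nat \<Rightarrow> ennreal"
  assumes fin: "(\<Sum>l. a l) < \<infinity>" and e: "e > 0"
  shows "\<exists>m. (\<Sum>l. a (l + m)) < ennreal e"
proof -
  let ?b = "\<lambda>l. enn2real (a l)"
  have "a l < \<infinity>" for l
    by (rule ennreal_suminf_lessD[OF fin])
  then have a: "a = (\<lambda>l. ennreal (?b l))"
    by (intro ext) (simp add: less_top)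
  have sm: "summable ?b"
    using fin a by (intro summable_suminf_not_top) (metis enn2real_nonneg, metis infinity_ennreal_def less_irrefl)
  obtain m where m: "norm (\<Sum>l. ?b (l + m)) < e"
    using suminf_exist_split[OF e sm] by blast
  have "(\<Sum>l. ennreal (?b (l + m))) = ennreal (\<Sum>l. ?b (l + m))"
    using summable_ignore_initial_segment[OF sm, of m] by (intro suminf_ennreal2) auto
  moreover have "0 \<le> (\<Sum>l. ?b (l + m))"
    using summable_ignore_initial_segment[OF sm, of m] by (intro suminf_nonneg) auto
  ultimately have "(\<Sum>l. ennreal (?b (l + m))) < ennreal e"
    using m by (simp add: ennreal_less_iff)
  then show ?thesis
    using fun_cong[OF a] by (metis (no_types, lifting) suminf_cong)
qed

lemma mu_at_ge:
  assumes \<mu>: "mono_on {1..} \<mu>" and n: "1 \<le> n" "enat n \<le> N"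
  shows "ennreal (\<mu> n) \<le> mu_at \<mu> N"
proof (cases N)
  case (enat m)
  then show ?thesis
    using mono_onD[OF \<mu>, of n m] n by (simp add: mu_at_def ennreal_leI)
qed (simp add: mu_at_def)

locale quasi_K_sigma_process = quasi_K_sigma M K nrm
  for M :: "'w measure" and K nrm +
  fixes T B :: "'t set" and \<rho> :: "'t \<Rightarrow> 't \<Rightarrow> real" and X :: "'t \<Rightarrow> 'w \<Rightarrow> real" and \<sigma> :: "real \<Rightarrow> real"
  assumes \<rho>: "pseudometric_on T \<rho>" and B: "compactin (pm_topology T \<rho>) B"
    and X: "\<And>t. t \<in> B \<Longrightarrow> X t \<in> K"
    and \<sigma>_cont: "continuous_on {0..} \<sigma>" and \<sigma>_mono: "mono_on {0..} \<sigma>" and \<sigma>_0: "\<sigma> 0 = 0"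
    and increment: "\<And>h s t. 0 \<le> h \<Longrightarrow> s \<in> B \<Longrightarrow> t \<in> B \<Longrightarrow> \<rho> t s \<le> h \<Longrightarrow>
      nrm (\<lambda>\<omega>. X t \<omega> - X s \<omega>) \<le> \<sigma> h"
begin

lemma BT: "B \<subseteq> T"
  using compactin_subset_topspace[OF B] by simp

lemma \<rho>_B: "pseudometric_on B \<rho>"
  using \<rho> BT unfolding pseudometric_on_def by (simp add: subset_iff)

lemma \<rho>_commute: "s \<in> B \<Longrightarrow> t \<in> B \<Longrightarrow> \<rho> s t = \<rho> t s"
  and \<rho>_nonneg: "s \<in> B \<Longrightarrow> t \<in> B \<Longrightarrow> 0 \<le> \<rho> s t"
  using \<rho>_B unfolding pseudometric_on_def by auto

text \<open>Continuity of \<open>\<sigma>\<close> at zero makes the process uniformly continuous in quasinorm.\<close>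

lemma nrm_continuous:
  assumes "e > 0"
  shows "\<exists>h>0. \<forall>s\<in>B. \<forall>t\<in>B. \<rho> s t < h \<longrightarrow> nrm (\<lambda>\<omega>. X s \<omega> - X t \<omega>) < e"
proof -
  have "\<exists>d>0. \<forall>h\<in>{0..}. dist h 0 < d \<longrightarrow> dist (\<sigma> h) (\<sigma> 0) < e"
    using \<sigma>_cont assms unfolding continuous_on_iff by (metis atLeast_iff order_refl)
  then obtain d where d: "d > 0" "\<And>h. 0 \<le> h \<Longrightarrow> h < d \<Longrightarrow> \<bar>\<sigma> h\<bar> < e"
    unfolding \<sigma>_0 by (auto simp: dist_real_def)
  have "nrm (\<lambda>\<omega>. X s \<omega> - X t \<omega>) < e" if "s \<in> B" "t \<in> B" "\<rho> s t < d" for s t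
    using increment[of "\<rho> s t" t s] d(2)[of "\<rho> s t"] \<rho>_nonneg[of s t] that by simp
  with d(1) show ?thesis
    by blast
qed

text \<open>At positive radii the nets are the centres of minimal covers.  If the radius \<open>\<epsilon> (Suc l)\<close> is zero,
  no cover by open balls exists and the covering number is infinite; then finiteness of the
  corresponding term of the series forces \<open>\<sigma> (\<epsilon> l) = 0\<close>, and the previous net can be used again.
  For this reason the nets are required to be dense in quasinorm rather than for \<open>\<rho>\<close>.  The net at
  level zero is the single centre of \<open>B\<close>.\<close>

lemma chaining_nets:
  assumes \<epsilon>: "decseq \<epsilon>" "\<epsilon> \<longlonglongrightarrow> 0" and t0: "t0 \<in> B" "\<And>t. t \<in> B \<Longrightarrow> \<rho> t t0 \<le> \<epsilon> 0"
    and fin: "\<And>l. mu_at \<mu> (covering_number \<rho> B (\<epsilon> (Suc l))) * ennreal (\<sigma> (\<epsilon> l)) < \<infinity>"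
  shows "\<exists>C. C 0 = {t0} \<and> (\<forall>l. finite (C l) \<and> C l \<noteq> {} \<and> C l \<subseteq> B \<and>
    (\<forall>t\<in>B. \<exists>u\<in>C l. nrm (\<lambda>\<omega>. X t \<omega> - X u \<omega>) \<le> \<sigma> (\<epsilon> l)) \<and>
    enat (card (C (Suc l))) \<le> covering_number \<rho> B (\<epsilon> (Suc l)))"
proof -
  have \<epsilon>0: "0 \<le> \<epsilon> l" for l
    using decseq_ge[OF \<epsilon>] .
  let ?net = "\<lambda>l C. finite C \<and> C \<noteq> {} \<and> C \<subseteq> B \<and>
    (\<forall>t\<in>B. \<exists>u\<in>C. nrm (\<lambda>\<omega>. X t \<omega> - X u \<omega>) \<le> \<sigma> (\<epsilon> l)) \<and>
    (if l = 0 then C = {t0} else enat (card C) \<le> covering_number \<rho> B (\<epsilon> l))"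
  have "\<exists>C. ?net l C" for l
  proof (induction l)
    case 0
    have "nrm (\<lambda>\<omega>. X t \<omega> - X t0 \<omega>) \<le> \<sigma> (\<epsilon> 0)" if "t \<in> B" for t
      using increment[OF \<epsilon>0 t0(1) that t0(2)] that by simp
    with t0(1) show ?case
      by (intro exI[of _ "{t0}"]) simp
  next
    case (Suc l)
    show ?case
    proof (cases "\<epsilon> (Suc l) > 0")
      case True
      obtain C where C: "finite C" "C \<subseteq> B" "B \<subseteq> (\<Union>x\<in>C. {y. \<rho> x y < \<epsilon> (Suc l)})"
        "covering_number \<rho> B (\<epsilon> (Suc l)) = enat (card C)"
        by (rule covering_number_attained[OF covering_number_finite[OF \<rho> B True]])
      have "\<exists>u\<in>C. nrm (\<lambda>\<omega>. X t \<omega> - X u \<omega>) \<le> \<sigma> (\<epsilon> (Suc l))" if t: "t \<in> B" for t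
      proof -
        obtain u where u: "u \<in> C" "\<rho> u t < \<epsilon> (Suc l)"
          using C(3) t by blast
        have uB: "u \<in> B"
          using C(2) u(1) by (simp add: subset_iff)
        have "nrm (\<lambda>\<omega>. X t \<omega> - X u \<omega>) \<le> \<sigma> (\<epsilon> (Suc l))"
          using increment[OF \<epsilon>0 uB t, of "Suc l"] \<rho>_commute[OF uB t] u(2) by simp
        with u(1) show ?thesis
          by blast
      qed
      moreover have "C \<noteq> {}"
        using C(3) t0(1) by blast
      ultimately show ?thesis
        using C by (intro exI[of _ C]) simp
    next
      case False
      with \<epsilon>0[of "Suc l"] have e: "\<epsilon> (Suc l) = 0"
        by simp
      have "{y. \<rho> x y < 0} \<inter> B = {}" if "x \<in> B" for x
        using \<rho>_nonneg[OF that] by force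
      then have "\<not> (C \<subseteq> B \<and> B \<subseteq> (\<Union>x\<in>C. {y. \<rho> x y < 0}))" for C
        using t0(1) by blast
      then have inf: "covering_number \<rho> B 0 = \<infinity>"
        unfolding covering_number_def by (simp add: Inf_enat_def)
      have "\<sigma> (\<epsilon> l) \<le> 0"
        using fin[of l] unfolding e inf mu_at_def
        by (simp add: ennreal_top_mult ennreal_eq_0_iff split: if_splits)
      then have \<sigma>l: "\<sigma> (\<epsilon> l) = 0"
        using mono_onD[OF \<sigma>_mono, of 0 "\<epsilon> l"] \<epsilon>0[of l] \<sigma>_0 by simp
      obtain C where "?net l C"
        using Suc.IH by blast
      then show ?thesis
        unfolding inf e \<sigma>_0 \<sigma>l by (intro exI[of _ C]) simp
    qed
  qed
  then have "\<forall>l. \<exists>C. ?net l C"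
    by blast
  then obtain C where C: "\<forall>l. ?net l (C l)"
    by (elim choice[THEN exE])
  show ?thesis
    by (rule exI[of _ C]) (use C in auto)
qed

text \<open>The two consequences of a finite chaining bound.  The remainder at level zero, added to the
  absolute value of \<open>X\<close> at the centre, dominates the process on \<open>B\<close>; the remainders at high levels have
  small quasinorm and yield a modulus of continuity.\<close>

lemma chaining:
  assumes \<mu>: "majorizing_characteristic K nrm \<mu>"
    and \<epsilon>: "decseq \<epsilon>" "\<epsilon> \<longlonglongrightarrow> 0" and t0: "t0 \<in> B" "\<And>t. t \<in> B \<Longrightarrow> \<rho> t t0 \<le> \<epsilon> 0"
    and fin: "chaining_bound nrm \<mu> \<sigma> \<rho> X B \<epsilon> < \<infinity>"
  shows "\<exists>\<eta>\<in>K. ennreal (nrm \<eta>) \<le> chaining_bound nrm \<mu> \<sigma> \<rho> X B \<epsilon> \<and> (\<forall>t\<in>B. AE \<omega> in M. \<bar>X t \<omega>\<bar> \<le> \<eta> \<omega>)"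
    and "as_modulus_on M B \<rho> X"
proof -
  define a where "a l = mu_at \<mu> (covering_number \<rho> B (\<epsilon> (Suc l))) * ennreal (\<sigma> (\<epsilon> l))" for l
  have bound: "chaining_bound nrm \<mu> \<sigma> \<rho> X B \<epsilon> = (SUP t\<in>B. ennreal (nrm (X t))) + (\<Sum>l. a l)"
    unfolding chaining_bound_def a_def ..
  have fin_a: "(\<Sum>l. a l) < \<infinity>"
    using fin unfolding bound by simp
  have "a l < \<infinity>" for l
    by (rule ennreal_suminf_lessD[OF fin_a])
  then have "\<exists>C. C 0 = {t0} \<and> (\<forall>l. finite (C l) \<and> C l \<noteq> {} \<and> C l \<subseteq> B \<and>
    (\<forall>t\<in>B. \<exists>u\<in>C l. nrm (\<lambda>\<omega>. X t \<omega> - X u \<omega>) \<le> \<sigma> (\<epsilon> l)) \<and>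
    enat (card (C (Suc l))) \<le> covering_number \<rho> B (\<epsilon> (Suc l)))"
    unfolding a_def by (intro chaining_nets[OF \<epsilon> t0])
  then obtain C where C0: "C 0 = {t0}" and C: "\<And>l. finite (C l)" "\<And>l. C l \<noteq> {}" "\<And>l. C l \<subseteq> B"
    and near: "\<And>l t. t \<in> B \<Longrightarrow> \<exists>u\<in>C l. nrm (\<lambda>\<omega>. X t \<omega> - X u \<omega>) \<le> \<sigma> (\<epsilon> l)"
    and card: "\<And>l. enat (card (C (Suc l))) \<le> covering_number \<rho> B (\<epsilon> (Suc l))"
    by auto
  have CB: "u \<in> B" if "u \<in> C l" for u l
    using C(3) that by blast
  have "(\<lambda>l. \<sigma> (\<epsilon> l)) \<longlonglongrightarrow> \<sigma> 0"
    using decseq_ge[OF \<epsilon>] by (intro continuous_on_tendsto_compose[OF \<sigma>_cont \<epsilon>(2)]) simp_all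
  then have s: "(\<lambda>l. \<sigma> (\<epsilon> l)) \<longlonglongrightarrow> 0"
    by (simp add: \<sigma>_0)
  have link: "ennreal (nrm (\<lambda>\<omega>. MAX u\<in>C (Suc l). \<bar>X u \<omega> - X (p u) \<omega>\<bar>)) \<le> a l"
    if p: "\<And>u. u \<in> C (Suc l) \<Longrightarrow> p u \<in> C l \<and> nrm (\<lambda>\<omega>. X u \<omega> - X (p u) \<omega>) \<le> \<sigma> (\<epsilon> l)" for l p
  proof -
    have "ennreal (nrm (\<lambda>\<omega>. MAX u\<in>C (Suc l). \<bar>X u \<omega> - X (p u) \<omega>\<bar>))
        \<le> ennreal (\<mu> (card (C (Suc l)))) * ennreal (\<sigma> (\<epsilon> l))"
      by (rule majorizing_finite[OF \<mu> C(1,2), of "Suc l" "\<lambda>u \<omega>. X u \<omega> - X (p u) \<omega>"])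
        (use p CB in \<open>auto intro!: K_diff X\<close>)
    also have "\<dots> \<le> a l"
      unfolding a_def
      using \<mu> C(1,2)[of "Suc l"] card[of l] unfolding majorizing_characteristic_def
      by (intro mult_right_mono mu_at_ge) (simp_all add: Suc_le_eq card_gt_0_iff)
    finally show ?thesis .
  qed
  have "\<exists>R. \<forall>m. R m \<in> K \<and> ennreal (nrm (R m)) \<le> (\<Sum>l. a (l + m)) \<and>
      (\<forall>t\<in>B. \<exists>v\<in>C m. AE \<omega> in M. \<bar>X t \<omega> - X v \<omega>\<bar> \<le> R m \<omega>)"
    by (rule chaining_remainders[OF X C near s link fin_a])
  then obtain R where R: "\<And>m. R m \<in> K" "\<And>m. ennreal (nrm (R m)) \<le> (\<Sum>l. a (l + m))"
    and R_le: "\<And>m. \<forall>t\<in>B. \<exists>v\<in>C m. AE \<omega> in M. \<bar>X t \<omega> - X v \<omega>\<bar> \<le> R m \<omega>"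
    by auto
  let ?\<eta> = "\<lambda>\<omega>. \<bar>X t0 \<omega>\<bar> + R 0 \<omega>"
  have \<eta>: "?\<eta> \<in> K"
    by (intro K_add K_abs X R t0)
  have "nrm ?\<eta> \<le> nrm (X t0) + nrm (R 0)"
    using nrm_triangle[OF K_abs[OF X[OF t0(1)]] R(1)[of 0]] nrm_abs[OF X[OF t0(1)]] by simp
  then have "ennreal (nrm ?\<eta>) \<le> ennreal (nrm (X t0)) + ennreal (nrm (R 0))"
    using nrm_nonneg[OF X[OF t0(1)]] nrm_nonneg[OF R(1)] by (simp flip: ennreal_plus add: ennreal_leI)
  also have "\<dots> \<le> (SUP t\<in>B. ennreal (nrm (X t))) + (\<Sum>l. a l)"
    using R(2)[of 0] t0(1) by (intro add_mono SUP_upper) simp_all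
  finally have "ennreal (nrm ?\<eta>) \<le> chaining_bound nrm \<mu> \<sigma> \<rho> X B \<epsilon>"
    unfolding bound .
  moreover have "AE \<omega> in M. \<bar>X t \<omega>\<bar> \<le> ?\<eta> \<omega>" if "t \<in> B" for t
  proof -
    have "AE \<omega> in M. \<bar>X t \<omega> - X t0 \<omega>\<bar> \<le> R 0 \<omega>"
      using R_le[of 0] that unfolding C0 by simp
    then show ?thesis
      by eventually_elim linarith
  qed
  ultimately show "\<exists>\<eta>\<in>K. ennreal (nrm \<eta>) \<le> chaining_bound nrm \<mu> \<sigma> \<rho> X B \<epsilon> \<and>
      (\<forall>t\<in>B. AE \<omega> in M. \<bar>X t \<omega>\<bar> \<le> \<eta> \<omega>)"
    using \<eta> by (intro bexI[of _ ?\<eta>] conjI ballI)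
  have "\<exists>R\<in>K. nrm R < e \<and> (\<exists>C. finite C \<and> C \<subseteq> B \<and>
      (\<forall>t\<in>B. \<exists>v\<in>C. AE \<omega> in M. \<bar>X t \<omega> - X v \<omega>\<bar> \<le> R \<omega>))" if e: "e > 0" for e
  proof -
    obtain m where "(\<Sum>l. a (l + m)) < ennreal e"
      using ennreal_suminf_tail_small[OF fin_a e] by blast
    with R(2)[of m] have "ennreal (nrm (R m)) < ennreal e"
      by (rule le_less_trans)
    then have "nrm (R m) < e"
      using nrm_nonneg[OF R(1)] by (simp add: ennreal_less_iff)
    then show ?thesis
      by (intro bexI[of _ "R m"] conjI exI[of _ "C m"] R(1) R_le C)
  qed
  then show "as_modulus_on M B \<rho> X"
    by (intro as_modulus_onI oscillation_dominated X nrm_continuous)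
qed

text \<open>The chaining estimate with the weight.  If \<open>j \<gamma>\<close> vanishes, the chaining bound may be infinite, but
  then \<open>\<gamma> * X t\<close> vanishes almost surely for every \<open>t\<close>, so either \<open>c\<close> vanishes on \<open>B\<close> or \<open>X\<close> does
  almost surely, and zero is a modulus of continuity.\<close>

lemma weighted_bound:
  fixes c :: "'t \<Rightarrow> real"
  assumes j: "subordinate_to K nrm j" and \<mu>: "majorizing_characteristic K nrm \<mu>"
    and \<epsilon>: "decseq \<epsilon>" "\<epsilon> \<longlonglongrightarrow> 0" and radius: "is_central_radius \<rho> B (\<epsilon> 0)"
    and c: "\<And>t. t \<in> B \<Longrightarrow> \<bar>c t\<bar> \<le> 1" and \<gamma>: "\<gamma> = (SUP t\<in>B. \<bar>c t\<bar>)"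
    and fin: "ennreal (j \<gamma>) * chaining_bound nrm \<mu> \<sigma> \<rho> X B \<epsilon> < \<infinity>"
  shows "\<exists>\<zeta>\<in>K. (\<forall>\<omega>. 0 \<le> \<zeta> \<omega>) \<and> ennreal (nrm \<zeta>) \<le> ennreal (j \<gamma>) * chaining_bound nrm \<mu> \<sigma> \<rho> X B \<epsilon> \<and>
      (\<forall>t\<in>B. AE \<omega> in M. \<bar>c t * X t \<omega>\<bar> \<le> \<zeta> \<omega>)"
    and "(\<forall>t\<in>B. c t = 0) \<or> as_modulus_on M B \<rho> X"
proof -
  let ?b = "chaining_bound nrm \<mu> \<sigma> \<rho> X B \<epsilon>"
  obtain t0 where t0: "t0 \<in> B" "\<And>t. t \<in> B \<Longrightarrow> \<rho> t t0 \<le> \<epsilon> 0"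
    using radius unfolding is_central_radius_def by blast
  have c\<gamma>: "\<bar>c t\<bar> \<le> \<gamma>" if "t \<in> B" for t
    unfolding \<gamma> using c that by (intro cSUP_upper bdd_aboveI2[of _ _ 1])
  have \<gamma>0: "0 \<le> \<gamma>"
    using c\<gamma>[OF t0(1)] by simp
  have \<gamma>1: "\<gamma> \<le> 1"
    unfolding \<gamma> using c t0(1) by (intro cSUP_least) auto
  have nrm_scale: "nrm (\<lambda>\<omega>. \<gamma> * \<xi> \<omega>) \<le> j \<gamma> * nrm \<xi>" if "\<xi> \<in> K" for \<xi>
    using j \<gamma>0 \<gamma>1 that unfolding subordinate_to_def by (metis abs_of_nonneg)
  have j0: "0 \<le> j \<gamma>"
    using j \<gamma>0 \<gamma>1 unfolding subordinate_to_def by simp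
  have "(\<exists>\<zeta>\<in>K. (\<forall>\<omega>. 0 \<le> \<zeta> \<omega>) \<and> ennreal (nrm \<zeta>) \<le> ennreal (j \<gamma>) * ?b \<and>
      (\<forall>t\<in>B. AE \<omega> in M. \<bar>c t * X t \<omega>\<bar> \<le> \<zeta> \<omega>)) \<and> ((\<forall>t\<in>B. c t = 0) \<or> as_modulus_on M B \<rho> X)"
  proof (cases "j \<gamma> = 0")
    case True
    have zero: "AE \<omega> in M. \<gamma> * X t \<omega> = 0" if "t \<in> B" for t
      using nrm_scale[OF X[OF that]] nrm_nonneg[OF K_scale[OF X[OF that], of \<gamma>]]
        nrm_eq_0_iff[OF K_scale[OF X[OF that], of \<gamma>]] True by simp
    have "AE \<omega> in M. \<bar>c t * X t \<omega>\<bar> \<le> 0" if "t \<in> B" for t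
      using zero[OF that]
    proof eventually_elim
      case (elim \<omega>)
      have "\<bar>c t * X t \<omega>\<bar> \<le> \<gamma> * \<bar>X t \<omega>\<bar>"
        using c\<gamma>[OF that] by (simp add: abs_mult mult_right_mono)
      also have "\<dots> = 0"
        using elim by auto
      finally show ?case .
    qed
    moreover have "as_modulus_on M B \<rho> X" if "\<gamma> \<noteq> 0"
    proof -
      have "AE \<omega> in M. \<bar>X s \<omega> - X t \<omega>\<bar> \<le> 0" if "s \<in> B" "t \<in> B" for s t
        using zero[OF that(1)] zero[OF that(2)] by eventually_elim (use \<open>\<gamma> \<noteq> 0\<close> in simp)
      then show ?thesis
        unfolding as_modulus_on_def by (intro exI[of _ "\<lambda>_ _. 0"] exI[of _ "\<lambda>_. 1"]) simp
    qed
    moreover have "\<forall>t\<in>B. c t = 0" if "\<gamma> = 0"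
      using c\<gamma> that by fastforce
    ultimately show ?thesis
      using K_zero by (intro conjI bexI[of _ "\<lambda>_. 0"]) (auto simp: nrm_zero)
  next
    case False
    have fin': "?b < \<infinity>"
      using fin False j0 by (auto simp: ennreal_mult_less_top ennreal_eq_0_iff)
    obtain \<eta> where \<eta>: "\<eta> \<in> K" "ennreal (nrm \<eta>) \<le> ?b" "\<forall>t\<in>B. AE \<omega> in M. \<bar>X t \<omega>\<bar> \<le> \<eta> \<omega>"
      using chaining(1)[OF \<mu> \<epsilon> t0 fin'] by blast
    let ?\<zeta> = "\<lambda>\<omega>. \<bar>\<gamma> * \<eta> \<omega>\<bar>"
    have \<zeta>: "?\<zeta> \<in> K"
      by (intro K_abs K_scale \<eta>)
    have "nrm ?\<zeta> \<le> j \<gamma> * nrm \<eta>"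
      using nrm_scale[OF \<eta>(1)] nrm_abs[OF K_scale[OF \<eta>(1), of \<gamma>]] by simp
    then have "ennreal (nrm ?\<zeta>) \<le> ennreal (j \<gamma>) * ennreal (nrm \<eta>)"
      using j0 nrm_nonneg[OF \<eta>(1)] by (simp flip: ennreal_mult add: ennreal_leI)
    also have "\<dots> \<le> ennreal (j \<gamma>) * ?b"
      by (intro mult_left_mono \<eta>) simp
    finally have "ennreal (nrm ?\<zeta>) \<le> ennreal (j \<gamma>) * ?b" .
    moreover have "AE \<omega> in M. \<bar>c t * X t \<omega>\<bar> \<le> ?\<zeta> \<omega>" if "t \<in> B" for t
      using \<eta>(3)[rule_format, OF that]
    proof eventually_elim
      case (elim \<omega>)
      then have "\<bar>c t\<bar> * \<bar>X t \<omega>\<bar> \<le> \<bar>\<gamma>\<bar> * \<bar>\<eta> \<omega>\<bar>"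
        using c\<gamma>[OF that] by (intro mult_mono) auto
      then show ?case
        by (simp add: abs_mult)
    qed
    ultimately show ?thesis
      using chaining(2)[OF \<mu> \<epsilon> t0 fin'] \<zeta> by (intro conjI disjI2 bexI[of _ ?\<zeta>]) auto
  qed
  then show "\<exists>\<zeta>\<in>K. (\<forall>\<omega>. 0 \<le> \<zeta> \<omega>) \<and> ennreal (nrm \<zeta>) \<le> ennreal (j \<gamma>) * ?b \<and>
      (\<forall>t\<in>B. AE \<omega> in M. \<bar>c t * X t \<omega>\<bar> \<le> \<zeta> \<omega>)"
    and "(\<forall>t\<in>B. c t = 0) \<or> as_modulus_on M B \<rho> X"
    by auto
qed

end


section \<open>The bound for the weighted supremum\<close>

theorem theorem1p2:
  fixes M :: "'w measure"
    and K :: "('w \<Rightarrow> real) set"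
    and nrm :: "('w \<Rightarrow> real) \<Rightarrow> real"
    and j :: "real \<Rightarrow> real"
    and \<mu> :: "nat \<Rightarrow> real"
    and T :: "'t set"
    and \<rho> :: "'t \<Rightarrow> 't \<Rightarrow> real"
    and B :: "nat \<Rightarrow> 't set"
    and X :: "'t \<Rightarrow> 'w \<Rightarrow> real"
    and \<sigma> :: "real \<Rightarrow> real"
    and c :: "'t \<Rightarrow> real"
    and \<epsilon> :: "nat \<Rightarrow> nat \<Rightarrow> real"
    and \<gamma> :: "nat \<Rightarrow> real"
    and rhs :: ennreal
  assumes "prob_space M"
    and "quasi_K_sigma_space M K nrm"
    and "subordinate_to K nrm j"
    and "majorizing_characteristic K nrm \<mu>"
    and "pseudometric_on T \<rho>" and "separable_space (pm_topology T \<rho>)"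
    and "T = (\<Union>k. B k)"
    and "\<And>k. compactin (pm_topology T \<rho>) (B k)"
    and "separable_process M T \<rho> X"
    and "\<And>t. t \<in> T \<Longrightarrow> X t \<in> K"
    and "continuous_on {0..} \<sigma>" and "mono_on {0..} \<sigma>" and "\<sigma> 0 = 0"
    and "\<And>h s t. 0 \<le> h \<Longrightarrow> s \<in> T \<Longrightarrow> t \<in> T \<Longrightarrow> \<rho> t s \<le> h \<Longrightarrow>
           nrm (\<lambda>\<omega>. X t \<omega> - X s \<omega>) \<le> \<sigma> h"
    and "\<And>t. t \<in> T \<Longrightarrow> \<bar>c t\<bar> < 1"
    and "\<And>k. decseq (\<epsilon> k)" and "\<And>k. \<epsilon> k \<longlonglongrightarrow> 0"
    and "\<And>k. is_central_radius \<rho> (B k) (\<epsilon> k 0)"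
    and "\<And>k. \<gamma> k = (SUP t\<in>B k. \<bar>c t\<bar>)"
    and "rhs = (\<Sum>k. ennreal (j (\<gamma> k)) * chaining_bound nrm \<mu> \<sigma> \<rho> X (B k) (\<epsilon> k))"
  shows "rhs < \<infinity> \<longrightarrow>
    (\<exists>\<xi>\<in>K. is_lattice_sup M T (\<lambda>t \<omega>. \<bar>c t * X t \<omega>\<bar>) \<xi> \<and>
       ((\<forall>k. separable_process M (B k) \<rho> X) \<or>
        separable_process M T \<rho> (\<lambda>t \<omega>. c t * X t \<omega>) \<longrightarrow>
          is_pointwise_sup M T (\<lambda>t \<omega>. \<bar>c t * X t \<omega>\<bar>) \<xi>) \<and>
       ennreal (nrm \<xi>) \<le> rhs)"
proof
  assume fin: "rhs < \<infinity>"
  interpret quasi_K_sigma M K nrm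
    by unfold_locales (rule assms(2))
  have BT: "B k \<subseteq> T" for k
    unfolding assms(7) by blast
  have process: "quasi_K_sigma_process M K nrm T (B k) \<rho> X \<sigma>" for k
    using BT[of k] by unfold_locales (auto intro: assms(5,8,10-14))
  have c1: "\<bar>c t\<bar> \<le> 1" if "t \<in> T" for t
    using assms(15)[OF that] by simp
  let ?b = "\<lambda>k. ennreal (j (\<gamma> k)) * chaining_bound nrm \<mu> \<sigma> \<rho> X (B k) (\<epsilon> k)"
  have fin_k: "?b k < \<infinity>" for k
    by (rule ennreal_suminf_lessD[OF fin[unfolded assms(20)]])
  note weighted = quasi_K_sigma_process.weighted_bound[OF process assms(3,4,16,17,18) _ assms(19) fin_k]
  \<comment> \<open>A common dominating element of \<open>K\<close> with the asserted quasinorm bound.\<close>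
  have "\<exists>\<zeta>\<in>K. (\<forall>\<omega>. 0 \<le> \<zeta> \<omega>) \<and> ennreal (nrm \<zeta>) \<le> ?b k \<and>
      (\<forall>t\<in>B k. AE \<omega> in M. \<bar>c t * X t \<omega>\<bar> \<le> \<zeta> \<omega>)" for k
    using BT[of k] by (intro weighted(1) c1) (simp add: subset_iff)
  then have "\<forall>k. \<exists>\<zeta>. \<zeta> \<in> K \<and> (\<forall>\<omega>. 0 \<le> \<zeta> \<omega>) \<and> ennreal (nrm \<zeta>) \<le> ?b k \<and>
      (\<forall>t\<in>B k. AE \<omega> in M. \<bar>c t * X t \<omega>\<bar> \<le> \<zeta> \<omega>)"
    by (simp only: Bex_def) simp
  then obtain \<zeta> where "\<forall>k. \<zeta> k \<in> K \<and> (\<forall>\<omega>. 0 \<le> \<zeta> k \<omega>) \<and> ennreal (nrm (\<zeta> k)) \<le> ?b k \<and>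
      (\<forall>t\<in>B k. AE \<omega> in M. \<bar>c t * X t \<omega>\<bar> \<le> \<zeta> k \<omega>)"
    by (elim choice[THEN exE])
  then have \<zeta>: "\<zeta> k \<in> K" "0 \<le> \<zeta> k \<omega>" "ennreal (nrm (\<zeta> k)) \<le> ?b k"
    and \<zeta>_le: "t \<in> B k \<Longrightarrow> AE \<omega> in M. \<bar>c t * X t \<omega>\<bar> \<le> \<zeta> k \<omega>" for k t \<omega>
    by simp_all
  have le_rhs: "(\<Sum>k. ennreal (nrm (\<zeta> k))) \<le> rhs"
    unfolding assms(20) by (intro suminf_le \<zeta> summableI)
  obtain \<eta> where \<eta>: "\<eta> \<in> K" "ennreal (nrm \<eta>) \<le> (\<Sum>k. ennreal (nrm (\<zeta> k)))"
    and sum_le: "AE \<omega> in M. \<forall>n. (\<Sum>k<n. \<zeta> k \<omega>) \<le> \<eta> \<omega>"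
    using series_dominated[OF \<zeta>(1,2) le_less_trans[OF le_rhs fin]] by (elim bexE conjE)
  have \<eta>_le: "AE \<omega> in M. \<bar>c t * X t \<omega>\<bar> \<le> \<eta> \<omega>" if tT: "t \<in> T" for t
  proof -
    obtain k where k: "t \<in> B k"
      using tT unfolding assms(7) by blast
    from \<zeta>_le[OF k] sum_le show ?thesis
    proof eventually_elim
      case (elim \<omega>)
      have "\<zeta> k \<omega> \<le> (\<Sum>i<Suc k. \<zeta> i \<omega>)"
        using \<zeta>(2) by (simp add: sum_nonneg)
      then show ?case
        using elim(1) spec[OF elim(2), of "Suc k"] by linarith
    qed
  qed
  \<comment> \<open>The supremum is taken over the union of sets \<open>D k \<subseteq> B k\<close>, since the modulus of continuity is only
    available within each \<open>B k\<close>.\<close>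
  have "\<forall>k. \<exists>D. countable D \<and> D \<subseteq> B k \<and> (\<forall>t\<in>B k. \<forall>e>0. \<exists>d\<in>D. \<rho> d t < e \<and> \<bar>c d - c t\<bar> < e)"
    using countable_weight_dense[OF assms(5,8)] by blast
  then obtain D where "\<forall>k. countable (D k) \<and> D k \<subseteq> B k \<and>
      (\<forall>t\<in>B k. \<forall>e>0. \<exists>d\<in>D k. \<rho> d t < e \<and> \<bar>c d - c t\<bar> < e)"
    by (elim choice[THEN exE])
  then have D: "countable (D k)" "D k \<subseteq> B k"
    and dense: "t \<in> B k \<Longrightarrow> e > 0 \<Longrightarrow> \<exists>d\<in>D k. \<rho> d t < e \<and> \<bar>c d - c t\<bar> < e" for k t e
    by simp_all
  have "B 0 \<noteq> {}"
    using assms(18)[of 0] unfolding is_central_radius_def by blast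
  then have ne: "(\<Union>k. D k) \<noteq> {}"
    using dense[of _ 0 1] by fastforce
  define d where "d = from_nat_into (\<Union>k. D k)"
  have range_d: "range d = (\<Union>k. D k)"
    unfolding d_def using D(1) ne by (intro range_from_nat_into) auto
  have dT: "d n \<in> T" for n
    using range_d D(2) BT by blast
  define \<xi> where "\<xi> = (\<lambda>\<omega>. SUP n. \<bar>c (d n) * X (d n) \<omega>\<bar>)"
  have cX: "(\<lambda>\<omega>. c t * X t \<omega>) \<in> K" if "t \<in> T" for t
    by (intro K_scale assms(10) that)
  have dom: "AE \<omega> in M. \<forall>n. \<bar>c (d n) * X (d n) \<omega>\<bar> \<le> \<eta> \<omega>"
    by (simp only: AE_all_countable) (intro allI \<eta>_le dT)
  have \<xi>: "\<xi> \<in> K"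
    unfolding \<xi>_def by (rule K_SUP[OF cX[OF dT] \<eta>(1) dom])
  have \<xi>_upper: "AE \<omega> in M. \<forall>n. \<bar>c (d n) * X (d n) \<omega>\<bar> \<le> \<xi> \<omega>"
    using dom
  proof eventually_elim
    case (elim \<omega>)
    then show ?case
      unfolding \<xi>_def by (intro allI cSUP_upper bdd_aboveI2[of _ _ "\<eta> \<omega>"]) auto
  qed
  have \<xi>_D: "AE \<omega> in M. \<forall>t\<in>D k. \<bar>c t * X t \<omega>\<bar> \<le> \<xi> \<omega>" for k
    using \<xi>_upper
  proof eventually_elim
    case (elim \<omega>)
    show ?case
    proof
      fix t assume "t \<in> D k"
      then obtain n where "t = d n"
        using range_d by blast
      then show "\<bar>c t * X t \<omega>\<bar> \<le> \<xi> \<omega>"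
        using elim by simp
    qed
  qed
  have \<xi>_least: "\<xi> \<omega> \<le> b" if "\<And>n. \<bar>c (d n) * X (d n) \<omega>\<bar> \<le> b" for \<omega> b
    unfolding \<xi>_def using that by (intro cSUP_least) auto
  have cases_k: "(\<forall>t\<in>B k. c t = 0) \<or> as_modulus_on M (B k) \<rho> X" for k
    using BT[of k] by (intro weighted(2) c1) (simp add: subset_iff)
  have \<xi>_ge_0: "AE \<omega> in M. 0 \<le> \<xi> \<omega>"
    using \<xi>_upper by eventually_elim (metis abs_ge_zero order_trans)
  have \<xi>_T: "AE \<omega> in M. \<bar>c t * X t \<omega>\<bar> \<le> \<xi> \<omega>" if tT: "t \<in> T" for t
  proof -
    obtain k where k: "t \<in> B k"
      using tT unfolding assms(7) by blast
    from cases_k[of k] show ?thesis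
    proof
      assume "\<forall>t\<in>B k. c t = 0"
      with k \<xi>_ge_0 show ?thesis by simp
    next
      assume modulus: "as_modulus_on M (B k) \<rho> X"
      show ?thesis
        by (rule AE_weighted_le[where c = c and t = t and \<rho> = \<rho> and X = X and \<xi> = \<xi>, OF D dense[OF k] modulus k c1[OF tT] \<xi>_D])
    qed
  qed
  have lattice: "is_lattice_sup M T (\<lambda>t \<omega>. \<bar>c t * X t \<omega>\<bar>) \<xi>"
    unfolding is_lattice_sup_def
  proof (intro conjI ballI impI)
    show "\<xi> \<in> borel_measurable M"
      by (rule K_measurable[OF \<xi>])
    fix z assume "\<forall>t\<in>T. AE \<omega> in M. \<bar>c t * X t \<omega>\<bar> \<le> z \<omega>"
    then have "AE \<omega> in M. \<forall>n. \<bar>c (d n) * X (d n) \<omega>\<bar> \<le> z \<omega>"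
      by (simp add: AE_all_countable dT)
    then show "AE \<omega> in M. \<xi> \<omega> \<le> z \<omega>"
      by eventually_elim (rule \<xi>_least, simp)
  qed (rule \<xi>_T)
  have pointwise: "is_pointwise_sup M T (\<lambda>t \<omega>. \<bar>c t * X t \<omega>\<bar>) \<xi>"
    if sep: "(\<forall>k. separable_process M (B k) \<rho> X) \<or> separable_process M T \<rho> (\<lambda>t \<omega>. c t * X t \<omega>)"
  proof -
    have "AE \<omega> in M. \<forall>t\<in>T. \<bar>c t * X t \<omega>\<bar> \<le> \<xi> \<omega>"
      using sep
    proof
      assume "separable_process M T \<rho> (\<lambda>t \<omega>. c t * X t \<omega>)"
      then show ?thesis
        using \<xi>_T by (rule separable_process_AE_le)
    next
      assume sep: "\<forall>k. separable_process M (B k) \<rho> X"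
      have "AE \<omega> in M. \<forall>t\<in>B k. \<bar>c t * X t \<omega>\<bar> \<le> \<xi> \<omega>" for k
        using cases_k[of k]
      proof
        assume "\<forall>t\<in>B k. c t = 0"
        with \<xi>_ge_0 show ?thesis by simp
      next
        assume modulus: "as_modulus_on M (B k) \<rho> X"
        show ?thesis
          using BT[of k]
          by (intro AE_weighted_le_pointwise[where c = c and \<xi> = \<xi>, OF quasi_K_sigma_process.\<rho>_B[OF process] _ D dense modulus c1 \<xi>_D])
            (auto simp: sep)
      qed
      then have "AE \<omega> in M. \<forall>k. \<forall>t\<in>B k. \<bar>c t * X t \<omega>\<bar> \<le> \<xi> \<omega>"
        by (intro AE_all_countable[THEN iffD2] allI)
      then show ?thesis
        by eventually_elim (simp add: assms(7))
    qed
    then show ?thesis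
      unfolding is_pointwise_sup_def
    proof eventually_elim
      case (elim \<omega>)
      then have bdd: "bdd_above ((\<lambda>t. \<bar>c t * X t \<omega>\<bar>) ` T)"
        by (intro bdd_aboveI2[of _ _ "\<xi> \<omega>"]) simp
      moreover have "\<xi> \<omega> \<le> (SUP t\<in>T. \<bar>c t * X t \<omega>\<bar>)"
        by (intro \<xi>_least cSUP_upper dT bdd)
      moreover have "(SUP t\<in>T. \<bar>c t * X t \<omega>\<bar>) \<le> \<xi> \<omega>"
        using elim dT by (intro cSUP_least) auto
      ultimately show ?case
        by simp
    qed
  qed
  have "nrm \<xi> \<le> nrm \<eta>"
    using dom \<xi>_ge_0
  proof (intro nrm_mono \<xi> \<eta>(1), eventually_elim)
    case (elim \<omega>)
    then show ?case
      using \<xi>_least[of \<omega> "\<eta> \<omega>"] by simp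
  qed
  then have "ennreal (nrm \<xi>) \<le> rhs"
    using \<eta>(2) le_rhs by (meson ennreal_leI order_trans)
  with \<xi> lattice pointwise show "\<exists>\<xi>\<in>K. is_lattice_sup M T (\<lambda>t \<omega>. \<bar>c t * X t \<omega>\<bar>) \<xi> \<and>
       ((\<forall>k. separable_process M (B k) \<rho> X) \<or>
        separable_process M T \<rho> (\<lambda>t \<omega>. c t * X t \<omega>) \<longrightarrow>
          is_pointwise_sup M T (\<lambda>t \<omega>. \<bar>c t * X t \<omega>\<bar>) \<xi>) \<and>
       ennreal (nrm \<xi>) \<le> rhs"
    by (intro bexI[of _ \<xi>] conjI impI)
qed

end
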